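(* Let $f$ be a frontal with a $k$-non-front singular point $p$ $(k\geq1)$. Then $p$ is an umbilic point of $f$, and a critical point of $\tilde\Gamma$. Moreover, if $f$ satisfies $\kappa_t\kappa_c'\neq0$ at $p$, then $\tilde\Gamma$ is a Morse function with index $0$ or $2$ at $p$; in particular, $p$ is an isolated umbilic point of $f$.
   Context: Let $V\subset\mathbb{R}^2$ be open. A $C^\infty$ map $f\colon V\to\mathbb{R}^3$ is a frontal if there is a $C^\infty$ map $\nu\colon V\to S^2$ (unit normal) with $\langle df_q(X),\nu(q)\rangle=0$ for all $q\in V$, $X\in T_qV$. A point is singular if $f$ is not an immersion there; $S(f)$ is the set of singular points. With $\lambda=\det(f_u,f_v,\nu)$ (signed area density), $p\in S(f)$ is non-degenerate if $d\lambda(p)\ne0$. Then on a neighborhood $U$ of $p$ the set $S(f)$ is the image of a regular $C^\infty$ curve $\gamma\colon(-\varepsilon,\varepsilon)\to U$, $\gamma(0)=p$ (the singular curve), and there is a nowhere-zero vector field $\eta$ on $U$ with $df_q(\eta_q)=0$ on $S(f)\cap U$ (a null vector field). $p$ is of the first kind if it is non-degenerate and $\eta$ is transverse to $\gamma$ at $p$. With $\hat\gamma=f\circ\gamma$ and $\psi(t)=\det(\hat\gamma',\nu\circ\gamma,(\eta\nu)\circ\gamma)(t)$, a singular point $p$ of the first kind is $k$-non-front ($k\ge1$) if $\psi(0)=\cdots=\psi^{(k-1)}(0)=0$ and $\psi^{(k)}(0)\ne0$. An adapted pair is a positively oriented pair $(\xi,\eta)$ with $\xi$ tangent to $\gamma$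 along $\gamma$ and $\eta$ a null vector field. A coordinate system $(U;u,v)$ is orthogonal adapted if the image of $\gamma$ is the $u$-axis, $(\partial_u,\partial_v)$ is an adapted pair, $|f_u(u,0)|=|f_{vv}(u,0)|=1$ and $\langle f_u,f_{vv}\rangle(u,0)=0$; such coordinates exist around $p$ and are taken. Let $K,H$ be the Gaussian and mean curvature on $U\setminus\{v=0\}$, $\Gamma=H^2-K$. The function $\tilde\Gamma=4\lambda^2\Gamma$ extends to a $C^\infty$ function on $U$, also denoted $\tilde\Gamma$. A point $q\in U$ is called an umbilic point of $f$ if $\tilde\Gamma(q)=0$. Along $\gamma$, for an adapted pair $(\xi,\eta)$: $\kappa_c=\frac{|\xi f|^{3/2}\det(\xi f,\eta^2f,\eta^3f)}{|\xi f\times\eta^2f|^{5/2}}$ (cuspidal curvature); $\kappa_t=\frac{\det(\xi f,\eta^2f,\xi\eta^2f)}{|\xi f\times\eta^2f|^2}-\frac{\det(\xi f,\eta^2f,\xi\xi f)\langle\xi f,\eta^2f\rangle}{|\xi f|^2|\xi f\times\eta^2f|^2}$ (cuspidal torsion), where $\eta^kf$ is the $k$-fold directional derivative. The prime is the derivative along $\gamma$. *)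

theory Defs
  imports "HOL-Analysis.Analysis"
begin

subsection \<open>Smooth maps and derivatives along vector fields\<close>

text \<open>For an open subset \<open>S\<close> of a finite-dimensional space this is the usual class \<open>C\<^sup>k\<close>.\<close>

primrec Ck_on :: "nat \<Rightarrow> 'a::euclidean_space set \<Rightarrow> ('a \<Rightarrow> 'b::real_normed_vector) \<Rightarrow> bool" where
  "Ck_on 0 S f \<longleftrightarrow> continuous_on S f"
| "Ck_on (Suc k) S f \<longleftrightarrow>
     (\<forall>x\<in>S. f differentiable (at x)) \<and> (\<forall>v. Ck_on k S (\<lambda>x. frechet_derivative f (at x) v))"

definition smooth_on :: "'a::euclidean_space set \<Rightarrow> ('a \<Rightarrow> 'b::real_normed_vector) \<Rightarrow> bool" where
  "smooth_on S f \<longleftrightarrow> (\<forall>k. Ck_on k S f)"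

definition dir_deriv ::
  "(real^2 \<Rightarrow> real^2) \<Rightarrow> (real^2 \<Rightarrow> 'b::real_normed_vector) \<Rightarrow> real^2 \<Rightarrow> 'b" where
  "dir_deriv X h q = frechet_derivative h (at q) (X q)"

definition partial :: "2 \<Rightarrow> (real^2 \<Rightarrow> 'b::real_normed_vector) \<Rightarrow> real^2 \<Rightarrow> 'b" where
  "partial i = dir_deriv (\<lambda>_. axis i 1)"

abbreviation det2 :: "real^2 \<Rightarrow> real^2 \<Rightarrow> real" where
  "det2 a b \<equiv> det (vector [a, b] :: real^2^2)"

abbreviation det3 :: "real^3 \<Rightarrow> real^3 \<Rightarrow> real^3 \<Rightarrow> real" where
  "det3 a b c \<equiv> det (vector [a, b, c] :: real^3^3)"


subsection \<open>Frontals and their singular points\<close>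

definition frontal :: "(real^2) set \<Rightarrow> (real^2 \<Rightarrow> real^3) \<Rightarrow> (real^2 \<Rightarrow> real^3) \<Rightarrow> bool" where
  "frontal V f \<nu> \<longleftrightarrow>
     open V \<and> smooth_on V f \<and> smooth_on V \<nu> \<and>
     (\<forall>q\<in>V. norm (\<nu> q) = 1 \<and> (\<forall>X. frechet_derivative f (at q) X \<bullet> \<nu> q = 0))"

definition singular_set :: "(real^2) set \<Rightarrow> (real^2 \<Rightarrow> real^3) \<Rightarrow> (real^2) set" where
  "singular_set V f = {q \<in> V. \<not> inj (frechet_derivative f (at q))}"

definition area_density :: "(real^2 \<Rightarrow> real^3) \<Rightarrow> (real^2 \<Rightarrow> real^3) \<Rightarrow> real^2 \<Rightarrow> real" where
  "area_density f \<nu> q = det3 (partial 1 f q) (partial 2 f q) (\<nu> q)"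

definition nondegenerate_singular ::
  "(real^2) set \<Rightarrow> (real^2 \<Rightarrow> real^3) \<Rightarrow> (real^2 \<Rightarrow> real^3) \<Rightarrow> real^2 \<Rightarrow> bool" where
  "nondegenerate_singular V f \<nu> p \<longleftrightarrow>
     p \<in> singular_set V f \<and> frechet_derivative (area_density f \<nu>) (at p) \<noteq> (\<lambda>_. 0)"

definition singular_curve ::
  "(real^2) set \<Rightarrow> (real^2 \<Rightarrow> real^3) \<Rightarrow> real^2 \<Rightarrow> (real^2) set \<Rightarrow> real \<Rightarrow> (real \<Rightarrow> real^2) \<Rightarrow> bool" where
  "singular_curve V f p U \<epsilon> \<gamma> \<longleftrightarrow>
     open U \<and> p \<in> U \<and> U \<subseteq> V \<and> \<epsilon> > 0 \<and> smooth_on {-\<epsilon><..<\<epsilon>} \<gamma> \<and>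
     (\<forall>t\<in>{-\<epsilon><..<\<epsilon>}. vector_derivative \<gamma> (at t) \<noteq> 0) \<and> \<gamma> 0 = p \<and>
     \<gamma> ` {-\<epsilon><..<\<epsilon>} = singular_set V f \<inter> U"

definition null_vector_field ::
  "(real^2) set \<Rightarrow> (real^2 \<Rightarrow> real^3) \<Rightarrow> (real^2) set \<Rightarrow> (real^2 \<Rightarrow> real^2) \<Rightarrow> bool" where
  "null_vector_field V f U \<eta> \<longleftrightarrow>
     smooth_on U \<eta> \<and> (\<forall>q\<in>U. \<eta> q \<noteq> 0) \<and> (\<forall>q \<in> singular_set V f \<inter> U. dir_deriv \<eta> f q = 0)"

definition first_kind ::
  "(real^2) set \<Rightarrow> (real^2 \<Rightarrow> real^3) \<Rightarrow> (real^2 \<Rightarrow> real^3) \<Rightarrow> real^2 \<Rightarrow>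
   (real^2) set \<Rightarrow> real \<Rightarrow> (real \<Rightarrow> real^2) \<Rightarrow> (real^2 \<Rightarrow> real^2) \<Rightarrow> bool" where
  "first_kind V f \<nu> p U \<epsilon> \<gamma> \<eta> \<longleftrightarrow>
     nondegenerate_singular V f \<nu> p \<and> singular_curve V f p U \<epsilon> \<gamma> \<and> null_vector_field V f U \<eta> \<and>
     det2 (vector_derivative \<gamma> (at 0)) (\<eta> p) \<noteq> 0"

definition psi ::
  "(real^2 \<Rightarrow> real^3) \<Rightarrow> (real^2 \<Rightarrow> real^3) \<Rightarrow> (real \<Rightarrow> real^2) \<Rightarrow> (real^2 \<Rightarrow> real^2) \<Rightarrow> real \<Rightarrow> real" where
  "psi f \<nu> \<gamma> \<eta> t =
     det3 (vector_derivative (f \<circ> \<gamma>) (at t)) (\<nu> (\<gamma> t)) (dir_deriv \<eta> \<nu> (\<gamma> t))"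

text \<open>The condition does not depend on the choice of \<open>\<gamma>\<close> and \<open>\<eta>\<close>; for \<open>k = 0\<close> it would say
  that \<open>f\<close> is a front at \<open>p\<close>.\<close>

definition non_front ::
  "nat \<Rightarrow> (real^2) set \<Rightarrow> (real^2 \<Rightarrow> real^3) \<Rightarrow> (real^2 \<Rightarrow> real^3) \<Rightarrow> real^2 \<Rightarrow> bool" where
  "non_front k V f \<nu> p \<longleftrightarrow>
     (\<exists>U \<epsilon> \<gamma> \<eta>. first_kind V f \<nu> p U \<epsilon> \<gamma> \<eta> \<and>
        (\<forall>i<k. (deriv ^^ i) (psi f \<nu> \<gamma> \<eta>) 0 = 0) \<and> (deriv ^^ k) (psi f \<nu> \<gamma> \<eta>) 0 \<noteq> 0)"


subsection \<open>Adapted pairs and the invariants along the singular curve\<close>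

definition adapted_pair ::
  "(real^2) set \<Rightarrow> (real^2 \<Rightarrow> real^3) \<Rightarrow> (real^2) set \<Rightarrow> real \<Rightarrow> (real \<Rightarrow> real^2) \<Rightarrow>
   (real^2 \<Rightarrow> real^2) \<Rightarrow> (real^2 \<Rightarrow> real^2) \<Rightarrow> bool" where
  "adapted_pair V f U \<epsilon> \<gamma> \<xi> \<eta> \<longleftrightarrow>
     smooth_on U \<xi> \<and> null_vector_field V f U \<eta> \<and> (\<forall>q\<in>U. det2 (\<xi> q) (\<eta> q) > 0) \<and>
     (\<forall>t\<in>{-\<epsilon><..<\<epsilon>}. \<xi> (\<gamma> t) \<in> span {vector_derivative \<gamma> (at t)})"

definition cuspidal_curvature ::
  "(real^2 \<Rightarrow> real^3) \<Rightarrow> (real^2 \<Rightarrow> real^2) \<Rightarrow> (real^2 \<Rightarrow> real^2) \<Rightarrow> real^2 \<Rightarrow> real" where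
  "cuspidal_curvature f \<xi> \<eta> q =
    (let \<xi>f = dir_deriv \<xi> f q;
         \<eta>2f = dir_deriv \<eta> (dir_deriv \<eta> f) q;
         \<eta>3f = dir_deriv \<eta> (dir_deriv \<eta> (dir_deriv \<eta> f)) q
     in norm \<xi>f powr (3/2) * det3 \<xi>f \<eta>2f \<eta>3f / norm (cross3 \<xi>f \<eta>2f) powr (5/2))"

definition cuspidal_torsion ::
  "(real^2 \<Rightarrow> real^3) \<Rightarrow> (real^2 \<Rightarrow> real^2) \<Rightarrow> (real^2 \<Rightarrow> real^2) \<Rightarrow> real^2 \<Rightarrow> real" where
  "cuspidal_torsion f \<xi> \<eta> q =
    (let \<xi>f = dir_deriv \<xi> f q;
         \<eta>2f = dir_deriv \<eta> (dir_deriv \<eta> f) q;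
         \<xi>\<eta>2f = dir_deriv \<xi> (dir_deriv \<eta> (dir_deriv \<eta> f)) q;
         \<xi>\<xi>f = dir_deriv \<xi> (dir_deriv \<xi> f) q
     in det3 \<xi>f \<eta>2f \<xi>\<eta>2f / (norm (cross3 \<xi>f \<eta>2f))\<^sup>2
        - det3 \<xi>f \<eta>2f \<xi>\<xi>f * (\<xi>f \<bullet> \<eta>2f) / ((norm \<xi>f)\<^sup>2 * (norm (cross3 \<xi>f \<eta>2f))\<^sup>2))"


subsection \<open>Orthogonal adapted coordinates\<close>

text \<open>A coordinate system on \<open>U\<close> is given by a parametrization \<open>\<phi>: W \<rightarrow> U\<close>, \<open>w = (u,v)\<close>, together
  with its inverse \<open>\<theta>\<close>; the coordinate vector fields are regarded as vector fields on \<open>U\<close>.\<close>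

definition coordinate_system ::
  "(real^2) set \<Rightarrow> (real^2) set \<Rightarrow> (real^2 \<Rightarrow> real^2) \<Rightarrow> (real^2 \<Rightarrow> real^2) \<Rightarrow> bool" where
  "coordinate_system U W \<phi> \<theta> \<longleftrightarrow>
     open U \<and> open W \<and> homeomorphism W U \<phi> \<theta> \<and> smooth_on W \<phi> \<and> smooth_on U \<theta>"

definition coord_field ::
  "(real^2 \<Rightarrow> real^2) \<Rightarrow> (real^2 \<Rightarrow> real^2) \<Rightarrow> 2 \<Rightarrow> real^2 \<Rightarrow> real^2" where
  "coord_field \<phi> \<theta> i q = partial i \<phi> (\<theta> q)"

definition orthogonal_adapted ::
  "(real^2) set \<Rightarrow> (real^2 \<Rightarrow> real^3) \<Rightarrow> (real^2) set \<Rightarrow> real \<Rightarrow> (real \<Rightarrow> real^2) \<Rightarrow>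
   (real^2) set \<Rightarrow> (real^2 \<Rightarrow> real^2) \<Rightarrow> (real^2 \<Rightarrow> real^2) \<Rightarrow> bool" where
  "orthogonal_adapted V f U \<epsilon> \<gamma> W \<phi> \<theta> \<longleftrightarrow>
     coordinate_system U W \<phi> \<theta> \<and>
     \<gamma> ` {-\<epsilon><..<\<epsilon>} = \<phi> ` {w \<in> W. w $ 2 = 0} \<and>
     adapted_pair V f U \<epsilon> \<gamma> (coord_field \<phi> \<theta> 1) (coord_field \<phi> \<theta> 2) \<and>
     (\<forall>w\<in>W. w $ 2 = 0 \<longrightarrow>
        norm (partial 1 (f \<circ> \<phi>) w) = 1 \<and>
        norm (partial 2 (partial 2 (f \<circ> \<phi>)) w) = 1 \<and>
        partial 1 (f \<circ> \<phi>) w \<bullet> partial 2 (partial 2 (f \<circ> \<phi>)) w = 0)"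


subsection \<open>Curvatures and umbilic points\<close>

text \<open>Here \<open>g\<close> is a map in coordinates \<open>(u,v)\<close> with unit normal \<open>n\<close>; the curvatures are meaningful
  where \<open>g\<close> is an immersion.\<close>

definition gaussian_curvature :: "(real^2 \<Rightarrow> real^3) \<Rightarrow> (real^2 \<Rightarrow> real^3) \<Rightarrow> real^2 \<Rightarrow> real" where
  "gaussian_curvature g n w =
    (let E = partial 1 g w \<bullet> partial 1 g w;
         F = partial 1 g w \<bullet> partial 2 g w;
         G = partial 2 g w \<bullet> partial 2 g w;
         L = partial 1 (partial 1 g) w \<bullet> n w;
         M = partial 1 (partial 2 g) w \<bullet> n w;
         N = partial 2 (partial 2 g) w \<bullet> n w
     in (L * N - M\<^sup>2) / (E * G - F\<^sup>2))"

definition mean_curvature :: "(real^2 \<Rightarrow> real^3) \<Rightarrow> (real^2 \<Rightarrow> real^3) \<Rightarrow> real^2 \<Rightarrow> real" where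
  "mean_curvature g n w =
    (let E = partial 1 g w \<bullet> partial 1 g w;
         F = partial 1 g w \<bullet> partial 2 g w;
         G = partial 2 g w \<bullet> partial 2 g w;
         L = partial 1 (partial 1 g) w \<bullet> n w;
         M = partial 1 (partial 2 g) w \<bullet> n w;
         N = partial 2 (partial 2 g) w \<bullet> n w
     in (E * N - 2 * F * M + G * L) / (2 * (E * G - F\<^sup>2)))"

text \<open>\<open>\<Gamma>t\<close> is the smooth extension to \<open>U\<close> of \<open>4 \<lambda>\<^sup>2 (H\<^sup>2 - K)\<close>, which is only defined off the
  singular curve \<open>v = 0\<close>; \<open>\<lambda>\<close> is taken in the coordinates \<open>\<phi>\<close>.  By density of \<open>v \<noteq> 0\<close>, the
  extension is unique on \<open>U\<close>.\<close>

definition is_Gamma_tilde ::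
  "(real^2 \<Rightarrow> real^3) \<Rightarrow> (real^2 \<Rightarrow> real^3) \<Rightarrow> (real^2) set \<Rightarrow> (real^2) set \<Rightarrow>
   (real^2 \<Rightarrow> real^2) \<Rightarrow> (real^2 \<Rightarrow> real) \<Rightarrow> bool" where
  "is_Gamma_tilde f \<nu> U W \<phi> \<Gamma>t \<longleftrightarrow>
     smooth_on U \<Gamma>t \<and>
     (\<forall>w\<in>W. w $ 2 \<noteq> 0 \<longrightarrow>
        \<Gamma>t (\<phi> w) = 4 * (area_density (f \<circ> \<phi>) (\<nu> \<circ> \<phi>) w)\<^sup>2 *
          ((mean_curvature (f \<circ> \<phi>) (\<nu> \<circ> \<phi>) w)\<^sup>2 - gaussian_curvature (f \<circ> \<phi>) (\<nu> \<circ> \<phi>) w))"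

definition umbilic_points :: "(real^2) set \<Rightarrow> (real^2 \<Rightarrow> real) \<Rightarrow> (real^2) set" where
  "umbilic_points U \<Gamma>t = {q \<in> U. \<Gamma>t q = 0}"


subsection \<open>Morse critical points\<close>

definition critical_point :: "(real^2 \<Rightarrow> real) \<Rightarrow> real^2 \<Rightarrow> bool" where
  "critical_point h p \<longleftrightarrow> (h has_derivative (\<lambda>_. 0)) (at p)"

definition hessian :: "(real^2 \<Rightarrow> real) \<Rightarrow> real^2 \<Rightarrow> real^2 \<Rightarrow> real^2 \<Rightarrow> real" where
  "hessian h p x y = frechet_derivative (\<lambda>q. frechet_derivative h (at q) y) (at p) x"

definition morse_at :: "(real^2 \<Rightarrow> real) \<Rightarrow> real^2 \<Rightarrow> bool" where
  "morse_at h p \<longleftrightarrow> critical_point h p \<and> (\<forall>x. (\<forall>y. hessian h p x y = 0) \<longrightarrow> x = 0)"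

definition morse_index :: "(real^2 \<Rightarrow> real) \<Rightarrow> real^2 \<Rightarrow> nat" where
  "morse_index h p =
     Max {dim S | S. subspace S \<and> (\<forall>x\<in>S. x \<noteq> 0 \<longrightarrow> hessian h p x x < 0)}"

end

theory Submission
  imports Defs
begin

text \<open>
  Write \<open>g = f \<circ> \<phi>\<close>, \<open>n = \<nu> \<circ> \<phi>\<close> and let \<open>E, F, G, L, M, N\<close> be the coefficients of the two
  fundamental forms of \<open>g\<close>.  Since \<open>\<lambda>\<^sup>2 = E G - F\<^sup>2\<close>, off the axis \<open>v = 0\<close>
  \<open>\<Gamma>t \<circ> \<phi> = (E N - 2 F M + G L)\<^sup>2 / (E G - F\<^sup>2) - 4 (L N - M\<^sup>2)\<close>.
  On the axis \<open>g\<^sub>v = 0\<close> while \<open>(g\<^sub>u, g\<^sub>v\<^sub>v, n)\<close> is an orthonormal frame.  Hence \<open>F\<close>, \<open>M\<close> and \<open>N\<close>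
  vanish there to first order and \<open>G\<close> to second order, and the quotient only has to be expanded
  along lines through the point that are transverse to the axis.

  The determinant \<open>\<psi>\<close> equals \<open>N\<^sub>v\<close> up to a nonzero factor, so at a non-front point \<open>N\<close> vanishes
  to second order.  Along the line \<open>\<theta> p + s (a, 1)\<close> one has \<open>E \<rightarrow> 1\<close>, \<open>G / s\<^sup>2 \<rightarrow> 1\<close>, \<open>F / s \<rightarrow> 0\<close>,
  \<open>M / s \<rightarrow> M\<^sub>v\<close> and \<open>N / s\<^sup>2 \<rightarrow> a N\<^sub>u\<^sub>v + N\<^sub>v\<^sub>v / 2\<close>, and therefore
  \<open>\<Gamma>t / s\<^sup>2 \<rightarrow> (a N\<^sub>u\<^sub>v + N\<^sub>v\<^sub>v / 2 - L)\<^sup>2 + 4 M\<^sub>v\<^sup>2\<close> (lemma \<open>Gamma_second_order\<close>).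
  As \<open>\<Gamma>t\<close> is smooth, these limits determine its value, gradient and Hessian
  (\<open>expansion_from_transverse_lines\<close>): the first two vanish, and half the Hessian in the direction
  \<open>(x, y)\<close> is \<open>(N\<^sub>u\<^sub>v x + (N\<^sub>v\<^sub>v / 2 - L) y)\<^sup>2 + 4 M\<^sub>v\<^sup>2 y\<^sup>2\<close>.

  For every adapted pair, \<open>\<kappa>\<^sub>c = \<plusminus> 2 N\<^sub>v\<close> and \<open>\<kappa>\<^sub>t = \<plusminus> M\<^sub>v\<close> along the singular curve
  (\<open>cuspidal_curvature_eq\<close>, \<open>cuspidal_torsion_eq\<close>).  If \<open>\<kappa>\<^sub>t \<kappa>\<^sub>c' \<noteq> 0\<close>, then \<open>N\<^sub>u\<^sub>v\<close> and \<open>M\<^sub>v\<close> are both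
  nonzero and the Hessian is positive definite, so \<open>\<Gamma>t\<close> has a strict minimum of Morse index 0.
\<close>


section \<open>Calculus of smooth maps\<close>

lemma has_derivative_cong_open:
  assumes "open S" "\<And>x. x \<in> S \<Longrightarrow> f x = g x" "x \<in> S"
  shows "(f has_derivative D) (at x) \<longleftrightarrow> (g has_derivative D) (at x)"
  using assms has_derivative_transform_within_open[of f D x UNIV S g]
    has_derivative_transform_within_open[of g D x UNIV S f] by metis

lemma frechet_derivative_cong_open:
  assumes "open S" "\<And>x. x \<in> S \<Longrightarrow> f x = g x" "x \<in> S"
  shows "frechet_derivative f (at x) = frechet_derivative g (at x)"
  using has_derivative_cong_open[OF assms] by (simp add: frechet_derivative_def)

lemma Ck_on_cong:
  assumes "open S" "\<And>x. x \<in> S \<Longrightarrow> f x = g x"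
  shows "Ck_on k S f \<longleftrightarrow> Ck_on k S g"
  using assms(2)
proof (induction k arbitrary: f g)
  case 0
  then show ?case by (simp cong: continuous_on_cong)
next
  case (Suc k)
  have "Ck_on k S (\<lambda>x. frechet_derivative f (at x) v) =
      Ck_on k S (\<lambda>x. frechet_derivative g (at x) v)" for v
    by (rule Suc.IH) (simp add: frechet_derivative_cong_open[OF assms(1) Suc.prems])
  moreover have "f differentiable at x \<longleftrightarrow> g differentiable at x" if "x \<in> S" for x
    using has_derivative_cong_open[OF assms(1) Suc.prems that] by (simp add: differentiable_def)
  ultimately show ?case by simp
qed

lemma smooth_on_cong:
  assumes "open S" "\<And>x. x \<in> S \<Longrightarrow> f x = g x" "smooth_on S f"
  shows "smooth_on S g"
  using assms(3) Ck_on_cong[OF assms(1,2)] unfolding smooth_on_def by simp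

lemma Ck_on_SucD: "Ck_on (Suc k) S f \<Longrightarrow> Ck_on k S f"
proof (induction k arbitrary: f)
  case 0
  then show ?case
    by (simp add: continuous_at_imp_continuous_on differentiable_imp_continuous_within)
next
  case (Suc k)
  have "Ck_on k S (\<lambda>x. frechet_derivative f (at x) v)" for v
    by (rule Suc.IH) (use Suc.prems in \<open>simp only: Ck_on.simps(2)[of "Suc k"]\<close>)
  then show ?case using Suc.prems by (simp only: Ck_on.simps(2)) blast
qed

lemma Ck_on_const: "Ck_on k S (\<lambda>_. c)"
  by (induction k arbitrary: c) auto

lemma Ck_on_linear:
  assumes "bounded_linear h"
  shows "Ck_on k S h"
proof -
  have "(h has_derivative h) (at x)" for x
    by (rule bounded_linear_imp_has_derivative[OF assms])
  then have "frechet_derivative h (at x) = h" "h differentiable at x" for x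
    by (metis frechet_derivative_at, metis differentiable_def)
  then show ?thesis
    using linear_continuous_on[OF assms] by (cases k) (simp_all add: Ck_on_const)
qed

lemma Ck_on_add:
  assumes "open S"
  shows "Ck_on k S f \<Longrightarrow> Ck_on k S g \<Longrightarrow> Ck_on k S (\<lambda>x. f x + g x)"
proof (induction k arbitrary: f g)
  case (Suc k)
  have D: "((\<lambda>x. f x + g x) has_derivative
      (\<lambda>v. frechet_derivative f (at x) v + frechet_derivative g (at x) v)) (at x)" if "x \<in> S" for x
    using Suc.prems that by (intro has_derivative_add) (auto simp: frechet_derivative_works[symmetric])
  have "Ck_on k S (\<lambda>x. frechet_derivative f (at x) v + frechet_derivative g (at x) v)" for v
    using Suc by simp
  then have "Ck_on k S (\<lambda>x. frechet_derivative (\<lambda>x. f x + g x) (at x) v)" for v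
    by (subst Ck_on_cong[OF assms]) (simp_all only: frechet_derivative_at[OF D, symmetric])
  then show ?case using D by (simp add: differentiable_def) blast
qed (auto intro: continuous_on_add)

lemma Ck_on_sum:
  assumes "open S" "\<And>i. i \<in> I \<Longrightarrow> Ck_on k S (f i)"
  shows "Ck_on k S (\<lambda>x. \<Sum>i\<in>I. f i x)"
  using assms by (induction I rule: infinite_finite_induct) (auto intro: Ck_on_const Ck_on_add)

lemma Ck_on_bilinear:
  assumes "open S" "bounded_bilinear B"
  shows "Ck_on k S f \<Longrightarrow> Ck_on k S g \<Longrightarrow> Ck_on k S (\<lambda>x. B (f x) (g x))"
proof (induction k arbitrary: f g)
  case 0
  then show ?case by (auto intro: bounded_bilinear.continuous_on[OF assms(2)])
next
  case (Suc k)
  have D: "((\<lambda>x. B (f x) (g x)) has_derivative (\<lambda>v. B (f x) (frechet_derivative g (at x) v) +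
      B (frechet_derivative f (at x) v) (g x))) (at x)" if "x \<in> S" for x
    using Suc.prems that
    by (intro bounded_bilinear.FDERIV[OF assms(2)]) (auto simp: frechet_derivative_works[symmetric])
  have "Ck_on k S (\<lambda>x. B (f x) (frechet_derivative g (at x) v) +
      B (frechet_derivative f (at x) v) (g x))" for v
    using Suc.prems Suc.prems[THEN Ck_on_SucD] by (intro Ck_on_add assms Suc.IH) auto
  then have "Ck_on k S (\<lambda>x. frechet_derivative (\<lambda>x. B (f x) (g x)) (at x) v)" for v
    by (subst Ck_on_cong[OF assms(1)]) (simp_all only: frechet_derivative_at[OF D, symmetric])
  then show ?case using D by (simp add: differentiable_def) blast
qed

text \<open>The derivative of a composition is expanded in the standard basis, so that the induction
  hypothesis applies to the partial derivatives of the outer map.\<close>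

lemma Ck_on_compose:
  fixes f :: "'b::euclidean_space \<Rightarrow> 'c::real_normed_vector"
  assumes "open S"
  shows "Ck_on k T f \<Longrightarrow> Ck_on k S g \<Longrightarrow> g ` S \<subseteq> T \<Longrightarrow> Ck_on k S (\<lambda>x. f (g x))"
proof (induction k arbitrary: f g)
  case 0
  then show ?case by (auto intro: continuous_on_compose2)
next
  case (Suc k)
  have D: "((\<lambda>x. f (g x)) has_derivative
      (\<lambda>v. frechet_derivative f (at (g x)) (frechet_derivative g (at x) v))) (at x)" if "x \<in> S" for x
    using Suc.prems that
    by (intro has_derivative_compose[of g _ x UNIV f]) (auto simp: frechet_derivative_works[symmetric])
  have E: "frechet_derivative (\<lambda>x. f (g x)) (at x) v =
     (\<Sum>b\<in>Basis. (frechet_derivative g (at x) v \<bullet> b) *\<^sub>R frechet_derivative f (at (g x)) b)"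
    if "x \<in> S" for x v
  proof -
    have "f differentiable at (g x)" using Suc.prems that by auto
    then have "linear (frechet_derivative f (at (g x)))"
      by (rule linear_frechet_derivative)
    then show ?thesis
      unfolding frechet_derivative_at[OF D[OF that], symmetric]
      by (subst (1) euclidean_representation[symmetric, of "frechet_derivative g (at x) v"])
         (simp add: linear_sum linear_scale)
  qed
  have "Ck_on k S (\<lambda>x. \<Sum>b\<in>Basis.
      (frechet_derivative g (at x) v \<bullet> b) *\<^sub>R frechet_derivative f (at (g x)) b)" for v
  proof (intro Ck_on_sum assms Ck_on_bilinear[OF assms bounded_bilinear_scaleR]
        Ck_on_bilinear[OF assms bounded_bilinear_inner] Ck_on_const)
    show "Ck_on k S (\<lambda>x. frechet_derivative g (at x) v)"
      using Suc.prems by simp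
    show "Ck_on k S (\<lambda>x. frechet_derivative f (at (g x)) b)" for b
      using Suc.prems Suc.prems(2)[THEN Ck_on_SucD]
      by (intro Suc.IH[of "\<lambda>y. frechet_derivative f (at y) b" g]) simp_all
  qed
  then have "Ck_on k S (\<lambda>x. frechet_derivative (\<lambda>x. f (g x)) (at x) v)" for v
    by (subst Ck_on_cong[OF assms(1) E])
  then show ?case using D by (simp add: differentiable_def) blast
qed

lemma smooth_on_differentiable: "smooth_on S f \<Longrightarrow> x \<in> S \<Longrightarrow> f differentiable at x"
  unfolding smooth_on_def by (meson Ck_on.simps(2))

lemma smooth_on_has_derivative:
  "smooth_on S f \<Longrightarrow> x \<in> S \<Longrightarrow> (f has_derivative frechet_derivative f (at x)) (at x)"
  using smooth_on_differentiable frechet_derivative_works by blast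

lemma smooth_on_continuous_on: "smooth_on S f \<Longrightarrow> continuous_on S f"
  unfolding smooth_on_def by (meson Ck_on.simps(1))

lemma smooth_on_subset: "T \<subseteq> S \<Longrightarrow> smooth_on S f \<Longrightarrow> smooth_on T f"
proof -
  assume "T \<subseteq> S"
  then have "Ck_on k S f \<Longrightarrow> Ck_on k T f" for k
    by (induction k arbitrary: f) (auto intro: continuous_on_subset)
  then show "smooth_on S f \<Longrightarrow> smooth_on T f"
    by (simp add: smooth_on_def)
qed

lemma smooth_on_frechet_derivative:
  "smooth_on S f \<Longrightarrow> smooth_on S (\<lambda>x. frechet_derivative f (at x) v)"
  unfolding smooth_on_def by (metis Ck_on.simps(2))

lemma smooth_on_partial: "smooth_on S f \<Longrightarrow> smooth_on S (partial i f)"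
  unfolding partial_def dir_deriv_def by (rule smooth_on_frechet_derivative)

lemma smooth_on_const: "smooth_on S (\<lambda>_. c)"
  by (simp add: smooth_on_def Ck_on_const)

lemma smooth_on_add: "open S \<Longrightarrow> smooth_on S f \<Longrightarrow> smooth_on S g \<Longrightarrow> smooth_on S (\<lambda>x. f x + g x)"
  by (simp add: smooth_on_def Ck_on_add)

lemma smooth_on_bilinear:
  "open S \<Longrightarrow> bounded_bilinear B \<Longrightarrow> smooth_on S f \<Longrightarrow> smooth_on S g \<Longrightarrow> smooth_on S (\<lambda>x. B (f x) (g x))"
  by (simp add: smooth_on_def Ck_on_bilinear)

lemma smooth_on_compose:
  fixes f :: "'b::euclidean_space \<Rightarrow> 'c::real_normed_vector"
  shows "open S \<Longrightarrow> smooth_on T f \<Longrightarrow> smooth_on S g \<Longrightarrow> g ` S \<subseteq> T \<Longrightarrow> smooth_on S (\<lambda>x. f (g x))"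
  unfolding smooth_on_def by (blast intro: Ck_on_compose)

lemma smooth_on_linear: "bounded_linear h \<Longrightarrow> smooth_on S h"
  by (simp add: smooth_on_def Ck_on_linear)

lemmas smooth_on_inner = smooth_on_bilinear[OF _ bounded_bilinear_inner]
lemmas smooth_on_scaleR = smooth_on_bilinear[OF _ bounded_bilinear_scaleR]
lemmas smooth_on_mult = smooth_on_bilinear[OF _ bounded_bilinear_mult]

lemma smooth_on_nth: "open S \<Longrightarrow> smooth_on S f \<Longrightarrow> smooth_on S (\<lambda>x. f x $ i)" for f :: "_ \<Rightarrow> real^'n"
  using smooth_on_compose[OF _ smooth_on_linear[OF bounded_linear_vec_nth] , of S f UNIV i] by auto

lemmas smooth_on_intros = smooth_on_const smooth_on_add smooth_on_inner smooth_on_scaleR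
  smooth_on_mult smooth_on_partial smooth_on_nth

section \<open>Partial derivatives in the plane\<close>

lemma has_derivative_partial:
  assumes "smooth_on S f" "x \<in> S"
  shows "(f has_derivative (\<lambda>z. z $ 1 *\<^sub>R partial 1 f x + z $ 2 *\<^sub>R partial 2 f x)) (at x)"
proof -
  have "frechet_derivative f (at x) z = z $ 1 *\<^sub>R partial 1 f x + z $ 2 *\<^sub>R partial 2 f x" for z
  proof -
    have "z = z $ 1 *\<^sub>R axis 1 1 + z $ 2 *\<^sub>R axis 2 1"
      by (simp add: vec_eq_iff axis_def forall_2)
    then have "frechet_derivative f (at x) z =
        frechet_derivative f (at x) (z $ 1 *\<^sub>R axis 1 1 + z $ 2 *\<^sub>R axis 2 1)" by simp
    also have "\<dots> = z $ 1 *\<^sub>R partial 1 f x + z $ 2 *\<^sub>R partial 2 f x"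
      using linear_frechet_derivative[OF smooth_on_differentiable[OF assms]]
      by (simp add: linear_add linear_scale partial_def dir_deriv_def)
    finally show ?thesis .
  qed
  then show ?thesis
    using smooth_on_has_derivative[OF assms] by presburger
qed

lemma partial_eqI: "(f has_derivative D) (at x) \<Longrightarrow> partial i f x = D (axis i 1)"
  by (simp add: partial_def dir_deriv_def frechet_derivative_at[symmetric])

lemma dir_deriv_eq_partial:
  assumes "smooth_on S f" "x \<in> S"
  shows "dir_deriv X f x = X x $ 1 *\<^sub>R partial 1 f x + X x $ 2 *\<^sub>R partial 2 f x"
  using frechet_derivative_at[OF has_derivative_partial[OF assms]]
  by (metis (no_types, lifting) dir_deriv_def)

lemma partial_cong_open:
  assumes "open S" "\<And>x. x \<in> S \<Longrightarrow> f x = g x" "x \<in> S"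
  shows "partial i f x = partial i g x"
  using frechet_derivative_cong_open[OF assms] by (simp add: partial_def dir_deriv_def)

lemma dir_deriv_cong_open:
  assumes "open S" "\<And>x. x \<in> S \<Longrightarrow> f x = g x" "x \<in> S"
  shows "dir_deriv X f x = dir_deriv X g x"
  using frechet_derivative_cong_open[OF assms] by (simp add: dir_deriv_def)

lemma partial_bilinear:
  assumes "bounded_bilinear B" "smooth_on S f" "smooth_on S g" "x \<in> S"
  shows "partial i (\<lambda>x. B (f x) (g x)) x = B (f x) (partial i g x) + B (partial i f x) (g x)"
  using partial_eqI[OF bounded_bilinear.FDERIV[OF assms(1) smooth_on_has_derivative[OF assms(2,4)]
        smooth_on_has_derivative[OF assms(3,4)]]]
  by (simp add: partial_def dir_deriv_def)

lemmas partial_inner = partial_bilinear[OF bounded_bilinear_inner]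
lemmas partial_scaleR = partial_bilinear[OF bounded_bilinear_scaleR]
lemmas partial_mult = partial_bilinear[OF bounded_bilinear_mult]

lemma partial_add:
  assumes "smooth_on S f" "smooth_on S g" "x \<in> S"
  shows "partial i (\<lambda>x. f x + g x) x = partial i f x + partial i g x"
  using partial_eqI[OF has_derivative_add[OF smooth_on_has_derivative[OF assms(1,3)]
        smooth_on_has_derivative[OF assms(2,3)]]]
  by (simp add: partial_def dir_deriv_def)

lemma partial_const: "partial i (\<lambda>_. c) x = 0"
  using partial_eqI[OF has_derivative_const] .

lemma partial_inner_const:
  assumes "smooth_on S f" "x \<in> S"
  shows "partial i (\<lambda>x. f x \<bullet> e) x = partial i f x \<bullet> e"
  using partial_inner[OF assms(1) smooth_on_const assms(2), of i e] by (simp add: partial_const)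

text \<open>Both mixed partial derivatives are limits of the same second difference quotient, which the
  mean value theorem, applied in one variable after the other, turns into a value of
  \<open>\<partial>\<^sub>j\<partial>\<^sub>i f\<close> near \<open>x\<close>.\<close>

lemma second_difference_mean_value:
  fixes f :: "real^2 \<Rightarrow> real"
  assumes "smooth_on S f" "cball x (2 * s) \<subseteq> S" "s > 0"
  shows "\<exists>y\<in>cball x (2 * s).
    f (x + s *\<^sub>R axis i 1 + s *\<^sub>R axis j 1) - f (x + s *\<^sub>R axis i 1) - f (x + s *\<^sub>R axis j 1) + f x
      = s\<^sup>2 * partial j (partial i f) y"
proof -
  let ?c = "\<lambda>t r. x + t *\<^sub>R axis i 1 + r *\<^sub>R axis j (1::real)"
  have in_ball: "?c t r \<in> cball x (2 * s)" if "0 \<le> t" "t \<le> s" "0 \<le> r" "r \<le> s" for t r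
  proof -
    have "norm (t *\<^sub>R axis i 1 + r *\<^sub>R axis j (1::real)) \<le> 2 * s"
      using norm_triangle_ineq[of "t *\<^sub>R axis i 1" "r *\<^sub>R axis j (1::real)"] that
      by (simp add: norm_axis_1)
    then show ?thesis by (metis add.assoc add_diff_cancel_left' dist_commute dist_norm mem_cball)
  qed
  have D1: "((\<lambda>t. h (?c t r)) has_real_derivative partial i h (?c t r)) (at t)"
    and D2: "((\<lambda>r. h (?c t r)) has_real_derivative partial j h (?c t r)) (at r)"
    if "smooth_on S h" "?c t r \<in> cball x (2 * s)" for h :: "real^2 \<Rightarrow> real" and t r
  proof -
    have D: "(h has_derivative frechet_derivative h (at (?c t r))) (at (?c t r))"
      using that assms(2) by (intro smooth_on_has_derivative) auto
    have L: "frechet_derivative h (at (?c t r)) (u *\<^sub>R z) = partial l h (?c t r) * u"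
      if "z = axis l 1" for u l z
      using linear_scale[OF has_derivative_linear[OF D]] that
      by (simp add: partial_def dir_deriv_def)
    have "((\<lambda>t. h (?c t r)) has_derivative (\<lambda>u. frechet_derivative h (at (?c t r)) (u *\<^sub>R axis i 1))) (at t)"
      by (rule has_derivative_compose[where g=h and f="\<lambda>t. ?c t r", OF _ D]) (auto intro!: derivative_eq_intros)
    then show "((\<lambda>t. h (?c t r)) has_real_derivative partial i h (?c t r)) (at t)"
      unfolding has_field_derivative_def by (simp add: L[OF refl])
    have "((\<lambda>r. h (?c t r)) has_derivative (\<lambda>u. frechet_derivative h (at (?c t r)) (u *\<^sub>R axis j 1))) (at r)"
      by (rule has_derivative_compose[where g=h and f="\<lambda>r. ?c t r", OF _ D]) (auto intro!: derivative_eq_intros)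
    then show "((\<lambda>r. h (?c t r)) has_real_derivative partial j h (?c t r)) (at r)"
      unfolding has_field_derivative_def by (simp add: L[OF refl])
  qed
  have "\<exists>t>0. t < s \<and> (f (?c s s) - f (?c s 0)) - (f (?c 0 s) - f (?c 0 0)) =
      (s - 0) * (partial i f (?c t s) - partial i f (?c t 0))"
    using assms by (intro MVT2) (auto intro!: DERIV_diff D1 in_ball simp del: scaleR_zero_left)
  then obtain t where t: "0 < t" "t < s" "f (?c s s) - f (?c s 0) - (f (?c 0 s) - f (?c 0 0)) =
      s * (partial i f (?c t s) - partial i f (?c t 0))" by auto
  have "\<exists>r>0. r < s \<and> partial i f (?c t s) - partial i f (?c t 0) =
      (s - 0) * partial j (partial i f) (?c t r)"
    using assms t by (intro MVT2) (auto intro!: D2 in_ball smooth_on_partial)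
  then obtain r where r: "0 < r" "r < s" "partial i f (?c t s) - partial i f (?c t 0) =
      s * partial j (partial i f) (?c t r)" by auto
  show ?thesis
    using t r in_ball[of t r] by (intro bexI[of _ "?c t r"]) (auto simp: power2_eq_square)
qed

lemma partial_commute_real:
  fixes f :: "real^2 \<Rightarrow> real"
  assumes "open S" "smooth_on S f" "x \<in> S"
  shows "partial i (partial j f) x = partial j (partial i f) x"
proof (rule ccontr)
  let ?a = "partial i (partial j f)" and ?b = "partial j (partial i f)"
  assume "?a x \<noteq> ?b x"
  define \<delta> where "\<delta> = \<bar>?a x - ?b x\<bar> / 2"
  have "\<delta> > 0" using \<open>?a x \<noteq> ?b x\<close> by (simp add: \<delta>_def)
  have "continuous (at x) ?a" "continuous (at x) ?b"
    using assms smooth_on_continuous_on[OF smooth_on_partial[OF smooth_on_partial[OF assms(2)]]]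
    by (auto simp: continuous_on_eq_continuous_at)
  then obtain d1 d2 where d: "d1 > 0" "\<And>y. dist y x < d1 \<Longrightarrow> dist (?a y) (?a x) < \<delta>"
    "d2 > 0" "\<And>y. dist y x < d2 \<Longrightarrow> dist (?b y) (?b x) < \<delta>"
    using \<open>\<delta> > 0\<close> unfolding continuous_at_eps_delta by metis
  obtain d3 where d3: "d3 > 0" "cball x d3 \<subseteq> S"
    using assms open_contains_cball by blast
  define s where "s = min (min d1 d2) d3 / 3"
  have s: "s > 0" "2 * s < d1" "2 * s < d2" "2 * s < d3" using d d3 by (auto simp: s_def min_def)
  then have sub: "cball x (2 * s) \<subseteq> S" using d3 by (meson less_imp_le order_trans subset_cball)
  from second_difference_mean_value[OF assms(2) sub s(1), of i j]
    second_difference_mean_value[OF assms(2) sub s(1), of j i]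
  obtain y z where yz: "y \<in> cball x (2 * s)" "z \<in> cball x (2 * s)" "s\<^sup>2 * ?b y = s\<^sup>2 * ?a z"
    by (auto simp: algebra_simps)
  then have "?b y = ?a z" using s by simp
  moreover have "dist (?a z) (?a x) < \<delta>" "dist (?b y) (?b x) < \<delta>"
    using d(2)[of z] d(4)[of y] yz s by (simp_all add: dist_commute)
  ultimately show False unfolding \<delta>_def dist_real_def by (auto simp: field_simps abs_if split: if_splits)
qed

text \<open>The vector valued case is reduced to components.\<close>

lemma partial_commute:
  fixes f :: "real^2 \<Rightarrow> 'b::euclidean_space"
  assumes "open S" "smooth_on S f" "x \<in> S"
  shows "partial i (partial j f) x = partial j (partial i f) x"
proof (rule euclidean_eqI)
  fix e :: 'b
  have "partial i (partial j (\<lambda>x. f x \<bullet> e)) x = partial i (partial j f) x \<bullet> e" for i j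
    by (simp add: partial_cong_open[OF assms(1) partial_inner_const[OF assms(2)] assms(3)]
      partial_inner_const[OF smooth_on_partial[OF assms(2)] assms(3)])
  then show "partial i (partial j f) x \<bullet> e = partial j (partial i f) x \<bullet> e"
    using partial_commute_real[OF assms(1) smooth_on_inner[OF assms(1,2) smooth_on_const] assms(3)]
    by metis
qed


section \<open>Second order behaviour along curves\<close>

text \<open>The second derivative as a quadratic form, with the two equal mixed terms collected.\<close>

definition hessian_form :: "(real^2 \<Rightarrow> real) \<Rightarrow> real^2 \<Rightarrow> real^2 \<Rightarrow> real" where
  "hessian_form h p z = (z $ 1)\<^sup>2 * partial 1 (partial 1 h) p
     + 2 * z $ 1 * z $ 2 * partial 1 (partial 2 h) p + (z $ 2)\<^sup>2 * partial 2 (partial 2 h) p"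

lemma DERIV_along_curve:
  fixes h :: "real^2 \<Rightarrow> real"
  assumes "smooth_on S h" "(c has_vector_derivative c') (at s)" "c s \<in> S"
  shows "((\<lambda>s. h (c s)) has_real_derivative
     c' $ 1 * partial 1 h (c s) + c' $ 2 * partial 2 h (c s)) (at s)"
proof -
  have "((\<lambda>s. h (c s)) has_derivative (\<lambda>r. (r *\<^sub>R c') $ 1 *\<^sub>R partial 1 h (c s)
       + (r *\<^sub>R c') $ 2 *\<^sub>R partial 2 h (c s))) (at s)"
    using assms(2) has_derivative_partial[OF assms(1,3)]
    unfolding has_vector_derivative_def by (rule has_derivative_compose)
  then show ?thesis
    unfolding has_field_derivative_def
    by (rule has_derivative_eq_rhs) (auto simp: algebra_simps)
qed

text \<open>At a critical zero \<open>c 0\<close> of \<open>h\<close> the acceleration of the curve does not contribute to the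
  second order term.\<close>

lemma second_order_along_curve:
  fixes h :: "real^2 \<Rightarrow> real"
  assumes S: "open S" "smooth_on S h" "c 0 \<in> S"
    and c: "\<And>s. s \<in> I \<Longrightarrow> (c has_vector_derivative c1 s) (at s)" "open I" "0 \<in> I"
    and c1: "(c1 has_vector_derivative c2) (at 0)"
    and h: "h (c 0) = 0" "partial 1 h (c 0) = 0" "partial 2 h (c 0) = 0"
  shows "((\<lambda>s. h (c s) / s\<^sup>2) \<longlongrightarrow> hessian_form h (c 0) (c1 0) / 2) (at 0)"
proof -
  define y' where "y' s = c1 s $ 1 * partial 1 h (c s) + c1 s $ 2 * partial 2 h (c s)" for s
  have cont: "isCont c 0"
    using has_vector_derivative_continuous[OF c(1)[OF c(3)]] .
  have ev: "\<forall>\<^sub>F s in at 0. c s \<in> S \<and> s \<in> I"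
  proof (rule eventually_conj)
    show "\<forall>\<^sub>F s in at 0. c s \<in> S"
      using cont S(1,3) unfolding isCont_def by (rule topological_tendstoD)
    show "\<forall>\<^sub>F s in at 0. s \<in> I"
      using c(2,3) by (rule eventually_at_in_open')
  qed
  have y: "((\<lambda>s. h (c s)) has_real_derivative y' s) (at s)" if "c s \<in> S" "s \<in> I" for s
    unfolding y'_def by (rule DERIV_along_curve[OF S(2) c(1)]) (use that in auto)
  have P: "((\<lambda>s. partial i h (c s)) has_real_derivative
     c1 0 $ 1 * partial 1 (partial i h) (c 0) + c1 0 $ 2 * partial 2 (partial i h) (c 0)) (at 0)" for i
    by (rule DERIV_along_curve[OF smooth_on_partial[OF S(2)] c(1)[OF c(3)] S(3)])
  have C: "((\<lambda>s. c1 s $ i) has_real_derivative c2 $ i) (at 0)" for i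
    using bounded_linear.has_vector_derivative[OF bounded_linear_vec_nth c1]
    by (simp add: has_real_derivative_iff_has_vector_derivative)
  have "(y' has_real_derivative hessian_form h (c 0) (c1 0)) (at 0)"
    unfolding y'_def
    by (rule derivative_eq_intros C P refl)+
      (simp add: h hessian_form_def partial_commute[OF S, of 2 1] power2_eq_square algebra_simps)
  moreover have "y' 0 = 0" by (simp add: y'_def h)
  ultimately have y'': "((\<lambda>s. y' s / s) \<longlongrightarrow> hessian_form h (c 0) (c1 0)) (at 0)"
    by (simp add: DERIV_def)
  have y2: "((\<lambda>s. y' s / (2 * s)) \<longlongrightarrow> hessian_form h (c 0) (c1 0) / 2) (at 0)"
    using tendsto_divide[OF y'' tendsto_const[of 2]] by (simp add: mult.commute)
  have "((\<lambda>s. h (c s)) \<longlongrightarrow> 0) (at 0)"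
    using DERIV_isCont[OF y[OF S(3) c(3)]] by (simp add: isCont_def h)
  moreover have "((\<lambda>s::real. s\<^sup>2) \<longlongrightarrow> 0) (at 0)"
    by (rule tendsto_eq_intros refl)+ simp
  moreover have "\<forall>\<^sub>F s in at (0::real). s\<^sup>2 \<noteq> 0" "\<forall>\<^sub>F s in at (0::real). 2 * s \<noteq> 0"
    by (auto simp: eventually_at_filter)
  moreover have "\<forall>\<^sub>F s in at 0. ((\<lambda>s. h (c s)) has_real_derivative y' s) (at s)"
    using ev by eventually_elim (auto intro: y)
  moreover have "\<forall>\<^sub>F s in at (0::real). ((\<lambda>s. s\<^sup>2) has_real_derivative 2 * s) (at s)"
    by (intro always_eventually allI) (auto intro!: derivative_eq_intros)
  ultimately show ?thesis
    using lhopital[of "\<lambda>s. h (c s)" 0 "\<lambda>s. s\<^sup>2" "\<lambda>s. 2 * s" y'] y2 by blast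
qed

lemma line_has_vector_derivative:
  "((\<lambda>s. w + s *\<^sub>R z) has_vector_derivative z) (at s)"
  by (auto intro!: derivative_eq_intros)

text \<open>Expansions along lines are kept as limits of quotients, the form in which they can be
  inserted into the rational expression for \<open>\<Gamma>t\<close>.\<close>

corollary second_order_along_line:
  fixes h :: "real^2 \<Rightarrow> real"
  assumes "open S" "smooth_on S h" "w \<in> S" "h w = 0" "partial 1 h w = 0" "partial 2 h w = 0"
  shows "((\<lambda>s. h (w + s *\<^sub>R z) / s\<^sup>2) \<longlongrightarrow> hessian_form h w z / 2) (at 0)"
  using second_order_along_curve[OF assms(1,2), of "\<lambda>s. w + s *\<^sub>R z" UNIV "\<lambda>_. z" 0] assms
    line_has_vector_derivative[of w z]
  by simp

corollary first_order_along_line: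
  fixes h :: "real^2 \<Rightarrow> real"
  assumes "smooth_on S h" "w \<in> S" "h w = 0"
  shows "((\<lambda>s. h (w + s *\<^sub>R z) / s) \<longlongrightarrow> z $ 1 * partial 1 h w + z $ 2 * partial 2 h w) (at 0)"
  using DERIV_along_curve[OF assms(1) line_has_vector_derivative, of w 0 z] assms(2,3)
  by (simp add: DERIV_def)

corollary zeroth_order_along_line:
  fixes h :: "real^2 \<Rightarrow> real"
  assumes "smooth_on S h" "w \<in> S"
  shows "((\<lambda>s. h (w + s *\<^sub>R z)) \<longlongrightarrow> h w) (at 0)"
  using DERIV_isCont[OF DERIV_along_curve[OF assms(1) line_has_vector_derivative, of w 0 z]] assms(2)
  by (simp add: isCont_def)

section \<open>Non-degenerate minima\<close>

text \<open>Definiteness of the diagonal values \<open>hessian h p x x\<close> already settles non-degeneracy and the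
  index; on the diagonal the bilinear form is the quadratic form above.\<close>

lemma hessian_diagonal:
  assumes "open S" "smooth_on S h" "p \<in> S"
  shows "hessian h p x x = hessian_form h p x"
proof -
  let ?k = "\<lambda>q. x $ 1 * partial 1 h q + x $ 2 * partial 2 h q"
  have k: "smooth_on S ?k"
    using assms by (intro smooth_on_intros)
  have D: "frechet_derivative h (at q) x = ?k q" if "q \<in> S" for q
    by (simp add: frechet_derivative_at[OF has_derivative_partial[OF assms(2) that], symmetric])
  have "hessian h p x x = frechet_derivative ?k (at p) x"
    unfolding hessian_def by (simp only: frechet_derivative_cong_open[OF assms(1) D assms(3)])
  also have "\<dots> = x $ 1 * partial 1 ?k p + x $ 2 * partial 2 ?k p"
    by (simp add: frechet_derivative_at[OF has_derivative_partial[OF k assms(3)], symmetric])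
  also have "\<dots> = hessian_form h p x"
    using assms
    by (simp add: partial_add[of S] partial_mult[of S] smooth_on_intros partial_const hessian_form_def
        partial_commute[OF assms, of 2 1] power2_eq_square algebra_simps)
  finally show ?thesis .
qed

lemma quadratic_form_pos_iff:
  fixes a b c :: real
  shows "(\<forall>x y. (x, y) \<noteq> (0, 0) \<longrightarrow> x\<^sup>2 * a + 2 * x * y * b + y\<^sup>2 * c > 0) \<longleftrightarrow> a > 0 \<and> a * c - b\<^sup>2 > 0"
proof (rule iffI, goal_cases)
  case 1
  then have pos: "\<forall>x y. (x, y) \<noteq> (0, 0) \<longrightarrow> x\<^sup>2 * a + 2 * x * y * b + y\<^sup>2 * c > 0" .
  have "a > 0" using pos[rule_format, of 1 0] by simp
  have "b\<^sup>2 * a + 2 * (- b) * a * b + a\<^sup>2 * c > 0"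
    using pos[rule_format, of "-b" a] \<open>a > 0\<close> by simp
  then have "a * (a * c - b\<^sup>2) > 0" by (simp add: power2_eq_square algebra_simps)
  then show ?case using \<open>a > 0\<close> by (simp add: zero_less_mult_iff)
next
  case 2
  have "x\<^sup>2 * a + 2 * x * y * b + y\<^sup>2 * c > 0" if "(x, y) \<noteq> (0, 0)" for x y
  proof -
    note * = 2 that
    have "a * (x\<^sup>2 * a + 2 * x * y * b + y\<^sup>2 * c) = (a * x + b * y)\<^sup>2 + (a * c - b\<^sup>2) * y\<^sup>2"
      by (simp add: power2_eq_square algebra_simps)
    moreover have "(a * x + b * y)\<^sup>2 + (a * c - b\<^sup>2) * y\<^sup>2 > 0"
      using * by (cases "y = 0") (auto intro: add_nonneg_pos)
    ultimately show "x\<^sup>2 * a + 2 * x * y * b + y\<^sup>2 * c > 0"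
      using * by (metis zero_less_mult_pos)
  qed
  then show ?case by blast
qed

text \<open>Positive definiteness, as a condition on two minors, is open.  Hence \<open>h\<close> is strictly convex on a
  ball around \<open>p\<close>, and a zero with vanishing gradient is the only zero in that ball.\<close>

lemma nondegenerate_minimum:
  assumes "open U" "smooth_on U h" "p \<in> U"
    and crit: "h p = 0" "partial 1 h p = 0" "partial 2 h p = 0"
    and pos: "\<And>x. x \<noteq> 0 \<Longrightarrow> hessian_form h p x > 0"
  shows "morse_at h p" "morse_index h p = 0" "p isolated_in {q \<in> U. h q = 0}"
proof -
  have "critical_point h p"
    using has_derivative_partial[OF assms(2,3)] crit by (simp add: critical_point_def)
  moreover have "x = 0" if "\<forall>y. hessian h p x y = 0" for x
    using that pos[of x] hessian_diagonal[OF assms(1-3), of x] by force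
  ultimately show "morse_at h p" by (auto simp: morse_at_def)
  have "{dim S | S. subspace S \<and> (\<forall>x\<in>S. x \<noteq> 0 \<longrightarrow> hessian h p x x < 0)} = {0}"
  proof (intro equalityI subsetI)
    fix n assume "n \<in> {dim S | S. subspace S \<and> (\<forall>x\<in>S. x \<noteq> 0 \<longrightarrow> hessian h p x x < 0)}"
    then obtain S where S: "n = dim S" "\<forall>x\<in>S. x \<noteq> 0 \<longrightarrow> hessian h p x x < 0" by blast
    \<comment> \<open>The Hessian cannot be negative anywhere, so only the zero subspace competes.\<close>
    then have "S \<subseteq> {0}"
      using pos hessian_diagonal[OF assms(1-3)] by (force dest: less_asym)
    then show "n \<in> {0}" using S(1) by (simp add: dim_eq_0)
  next
    fix n :: nat assume "n \<in> {0}"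
    then show "n \<in> {dim S | S. subspace S \<and> (\<forall>x\<in>S. x \<noteq> 0 \<longrightarrow> hessian h p x x < 0)}"
      by (simp, intro exI[of _ "{0}"]) (simp add: subspace_0)
  qed
  then show "morse_index h p = 0" by (simp add: morse_index_def)
  let ?a = "partial 1 (partial 1 h)" and ?b = "partial 1 (partial 2 h)" and ?c = "partial 2 (partial 2 h)"
  let ?d = "\<lambda>q. ?a q * ?c q - (?b q)\<^sup>2"
  have cont: "continuous_on U (partial i (partial j h))" for i j
    by (intro smooth_on_continuous_on smooth_on_partial assms)
  have form_pos: "(\<forall>x. x \<noteq> 0 \<longrightarrow> hessian_form h q x > 0) \<longleftrightarrow> ?a q > 0 \<and> ?d q > 0" for q
    unfolding quadratic_form_pos_iff[symmetric] hessian_form_def forall_vector_2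
    by (simp add: vec_eq_iff forall_2)
  have "open (U \<inter> ?a -` {0<..})" "open (U \<inter> ?d -` {0<..})"
    using assms(1) by (auto intro!: continuous_open_preimage continuous_intros cont)
  then have "open (U \<inter> ?a -` {0<..} \<inter> (U \<inter> ?d -` {0<..}))" by (rule open_Int)
  moreover have "p \<in> U \<inter> ?a -` {0<..} \<inter> (U \<inter> ?d -` {0<..})"
    using form_pos[of p] pos assms(3) by auto
  ultimately obtain r where r: "r > 0" "ball p r \<subseteq> U \<inter> ?a -` {0<..} \<inter> (U \<inter> ?d -` {0<..})"
    using openE by blast
  have "h q > 0" if q: "q \<in> ball p r" "q \<noteq> p" for q
  proof -
    define x where "x = q - p"
    have "x \<noteq> 0" using q by (simp add: x_def)
    have in_ball: "p + t *\<^sub>R x \<in> ball p r" if "0 \<le> t" "t \<le> 1" for t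
    proof -
      have "t * norm x \<le> norm x" using that by (simp add: mult_left_le_one_le)
      moreover have "norm x < r" using q by (simp add: x_def dist_norm norm_minus_commute)
      ultimately show ?thesis using that by (simp add: dist_norm)
    qed
    define y' where "y' t = x $ 1 * partial 1 h (p + t *\<^sub>R x) + x $ 2 * partial 2 h (p + t *\<^sub>R x)" for t
    have y1: "((\<lambda>t. h (p + t *\<^sub>R x)) has_real_derivative y' t) (at t)" if "0 \<le> t" "t \<le> 1" for t
      unfolding y'_def using subsetD[OF r(2) in_ball[OF that]]
      by (intro DERIV_along_curve[OF assms(2) line_has_vector_derivative]) simp
    have y2: "(y' has_real_derivative hessian_form h (p + t *\<^sub>R x) x) (at t)" if "0 \<le> t" "t \<le> 1" for t
    proof -
      have U: "p + t *\<^sub>R x \<in> U" using in_ball[OF that] r by auto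
      show ?thesis
        unfolding y'_def
        by (rule derivative_eq_intros DERIV_along_curve[OF smooth_on_partial[OF assms(2)] line_has_vector_derivative U] refl)+
          (simp add: hessian_form_def partial_commute[OF assms(1,2) U, of 2 1] power2_eq_square algebra_simps)
    qed
    obtain t where t: "0 < t" "t < 1" "h (p + 1 *\<^sub>R x) - h (p + 0 *\<^sub>R x) = (1 - 0) * y' t"
      using MVT2[of 0 1 "\<lambda>t. h (p + t *\<^sub>R x)" y'] y1 by auto
    obtain t' where t': "0 < t'" "t' < t" "y' t - y' 0 = (t - 0) * hessian_form h (p + t' *\<^sub>R x) x"
      using MVT2[of 0 t y' "\<lambda>t. hessian_form h (p + t *\<^sub>R x) x"] y2 t by auto
    have "hessian_form h (p + t' *\<^sub>R x) x > 0"
      using form_pos[of "p + t' *\<^sub>R x"] subsetD[OF r(2) in_ball[of t']] t t' \<open>x \<noteq> 0\<close> by simp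
    then have "y' t > 0" using t' t crit by (simp add: y'_def[of 0])
    then show ?thesis using t crit by (simp add: x_def)
  qed
  then have "q = p" if "q \<in> U" "h q = 0" "dist p q < r" for q
    using that by (metis less_irrefl mem_ball)
  then show "p isolated_in {q \<in> U. h q = 0}"
    unfolding isolated_in_dist_Ex_iff using r(1) assms(3) crit(1) by blast
qed

section \<open>Change of coordinates at a critical zero\<close>

text \<open>In \<open>h \<circ> \<phi>\<close> the second derivatives of \<open>\<phi>\<close> are paired with the gradient of \<open>h\<close>, which vanishes.
  Instead of differentiating the composition twice, the limit of \<open>h (\<phi> (w + s z)) / s\<^sup>2\<close> is computed
  in two ways: along a line for \<open>h \<circ> \<phi>\<close>, and along the image curve for \<open>h\<close>.\<close>

lemma hessian_form_compose:
  fixes h :: "real^2 \<Rightarrow> real"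
  assumes h: "open U" "smooth_on U h" and \<phi>: "open W" "smooth_on W \<phi>" "\<phi> ` W \<subseteq> U" and w: "w \<in> W"
    and crit: "h (\<phi> w) = 0" "partial 1 h (\<phi> w) = 0" "partial 2 h (\<phi> w) = 0"
  shows "hessian_form (\<lambda>w. h (\<phi> w)) w z = hessian_form h (\<phi> w) (frechet_derivative \<phi> (at w) z)"
proof -
  let ?Q = "\<lambda>w. h (\<phi> w)"
  have Q: "smooth_on W ?Q"
    by (rule smooth_on_compose[OF \<phi>(1) h(2) \<phi>(2,3)])
  have "(h has_derivative (\<lambda>_. 0)) (at (\<phi> w))"
    using has_derivative_partial[OF h(2), of "\<phi> w"] \<phi>(3) w crit by auto
  then have D: "(?Q has_derivative (\<lambda>_. 0)) (at w)"
    by (rule has_derivative_compose[OF smooth_on_has_derivative[OF \<phi>(2) w]])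
  have Q0: "?Q w = 0" "partial 1 ?Q w = 0" "partial 2 ?Q w = 0"
    using crit by (auto simp: partial_eqI[OF D])
  define l where "l = (\<lambda>s. w + s *\<^sub>R z)"
  have l: "(l has_vector_derivative z) (at s)" for s
    unfolding l_def by (rule line_has_vector_derivative)
  define I where "I = l -` W"
  have I: "open I" "0 \<in> I"
    unfolding I_def using w l
    by (auto intro!: continuous_open_vimage \<phi>(1) simp: l_def)
  define c1 where "c1 = (\<lambda>s. frechet_derivative \<phi> (at (l s)) z)"
  have c: "((\<lambda>s. \<phi> (l s)) has_vector_derivative c1 s) (at s)" if "s \<in> I" for s
  proof -
    have D: "(\<phi> has_derivative frechet_derivative \<phi> (at (l s))) (at (l s))"
      using that by (intro smooth_on_has_derivative[OF \<phi>(2)]) (auto simp: I_def)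
    then show ?thesis
      using vector_derivative_diff_chain_within[OF l has_derivative_at_withinI[OF D]]
      by (simp add: c1_def o_def)
  qed
  have "l 0 \<in> W" using w by (simp add: l_def)
  have "\<exists>c2. (c1 has_vector_derivative c2) (at 0)"
  proof -
    have D: "((\<lambda>q. frechet_derivative \<phi> (at q) z) has_derivative
        frechet_derivative (\<lambda>q. frechet_derivative \<phi> (at q) z) (at (l 0))) (at (l 0))"
      by (rule smooth_on_has_derivative[OF smooth_on_frechet_derivative[OF \<phi>(2)] \<open>l 0 \<in> W\<close>])
    then show ?thesis
      using vector_derivative_diff_chain_within[OF l has_derivative_at_withinI[OF D]]
      by (auto simp: c1_def o_def)
  qed
  then obtain c2 where "(c1 has_vector_derivative c2) (at 0)" by blast
  then have "((\<lambda>s. h (\<phi> (l s)) / s\<^sup>2) \<longlongrightarrow> hessian_form h (\<phi> w) (c1 0) / 2) (at 0)"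
    using second_order_along_curve[OF h, of "\<lambda>s. \<phi> (l s)" I c1 c2] c I w crit \<phi>(3)
    by (auto simp: l_def)
  moreover have "((\<lambda>s. h (\<phi> (l s)) / s\<^sup>2) \<longlongrightarrow> hessian_form ?Q w z / 2) (at 0)"
    using second_order_along_line[OF \<phi>(1) Q w Q0] by (simp add: l_def)
  ultimately have "hessian_form h (\<phi> w) (c1 0) / 2 = hessian_form ?Q w z / 2"
    by (rule tendsto_unique[rotated]) simp
  then show ?thesis by (simp add: c1_def l_def)
qed

text \<open>The expansion of \<open>Q\<close> is a polynomial in the direction, of degree at most two, so it is
  determined by the directions \<open>(a, 1)\<close>; this recovers the direction of the axis itself, along
  which the quotient defining \<open>\<Gamma>t\<close> is meaningless.\<close>

lemma expansion_from_transverse_lines: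
  fixes Q :: "real^2 \<Rightarrow> real"
  assumes Q: "open W" "smooth_on W Q" "w \<in> W"
    and lim: "\<And>a. ((\<lambda>s. Q (w + s *\<^sub>R vector [a, 1]) / s\<^sup>2) \<longlongrightarrow> (A * a + B)\<^sup>2 + C) (at 0)"
  shows "Q w = 0" "partial 1 Q w = 0" "partial 2 Q w = 0"
    and "hessian_form Q w z = 2 * ((A * z $ 1 + B * z $ 2)\<^sup>2 + C * (z $ 2)\<^sup>2)"
proof -
  have s: "((\<lambda>s::real. s) \<longlongrightarrow> 0) (at 0)" by (rule tendsto_ident_at)
  have nz: "\<forall>\<^sub>F s in at (0::real). s \<noteq> 0" by (simp add: eventually_at_filter)
  have lim1: "((\<lambda>s. Q (w + s *\<^sub>R vector [a, 1]) / s) \<longlongrightarrow> 0) (at 0)" for a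
  proof -
    have "((\<lambda>s. Q (w + s *\<^sub>R vector [a, 1]) / s\<^sup>2 * s) \<longlongrightarrow> 0) (at 0)"
      using tendsto_mult[OF lim[of a] s] by simp
    then show ?thesis
      by (rule Lim_transform_eventually)
        (use nz in \<open>eventually_elim, simp add: power2_eq_square\<close>)
  qed
  have "((\<lambda>s. Q (w + s *\<^sub>R vector [0, 1]) / s * s) \<longlongrightarrow> 0) (at 0)"
    using tendsto_mult[OF lim1[of 0] s] by simp
  then have "((\<lambda>s. Q (w + s *\<^sub>R vector [0, 1])) \<longlongrightarrow> 0) (at 0)"
    by (rule Lim_transform_eventually) (use nz in \<open>eventually_elim, simp\<close>)
  from tendsto_unique[OF _ zeroth_order_along_line[OF Q(2,3)] this]
  show Q0: "Q w = 0" by simp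
  have *: "a * partial 1 Q w + partial 2 Q w = 0" for a
    using tendsto_unique[OF _ lim1[of a] first_order_along_line[OF Q(2,3) Q0, of "vector [a, 1]"]] by simp
  from *[of 0] show p2: "partial 2 Q w = 0" by simp
  with *[of 1] show p1: "partial 1 Q w = 0" by simp
  have H: "hessian_form Q w (vector [a, 1]) = 2 * ((A * a + B)\<^sup>2 + C)" for a
    using tendsto_unique[OF _ lim[of a] second_order_along_line[OF Q Q0 p1 p2, of "vector [a, 1]"]] by simp
  \<comment> \<open>Three values of the slope determine the three coefficients of the quadratic form.\<close>
  have "partial 2 (partial 2 Q) w = 2 * (B\<^sup>2 + C)" "partial 1 (partial 1 Q) w = 2 * A\<^sup>2"
    "partial 1 (partial 2 Q) w = 2 * A * B"
    using H[of 0] H[of 1] H[of "-1"] by (simp_all add: hessian_form_def power2_eq_square algebra_simps)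
  then show "hessian_form Q w z = 2 * ((A * z $ 1 + B * z $ 2)\<^sup>2 + C * (z $ 2)\<^sup>2)"
    by (simp add: hessian_form_def power2_eq_square algebra_simps)
qed


section \<open>Determinants of triples of vectors\<close>

text \<open>The product of one matrix with the transpose of another has the inner products of the rows as
  entries; for equal triples this is the Gram determinant.\<close>

lemma det3_mult_det3:
  fixes a b c x y z :: "real^3"
  shows "det3 a b c * det3 x y z =
     (a \<bullet> x) * ((b \<bullet> y) * (c \<bullet> z) - (b \<bullet> z) * (c \<bullet> y))
   - (a \<bullet> y) * ((b \<bullet> x) * (c \<bullet> z) - (b \<bullet> z) * (c \<bullet> x))
   + (a \<bullet> z) * ((b \<bullet> x) * (c \<bullet> y) - (b \<bullet> y) * (c \<bullet> x))"
  unfolding det_3 inner_vec_def sum_3 vector_3 inner_real_def by algebra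

text \<open>This gives \<open>\<lambda>\<^sup>2 = E G - F\<^sup>2\<close>, also at singular points.\<close>

lemma det3_unit_normal:
  fixes a b n :: "real^3"
  assumes "n \<bullet> n = 1" "a \<bullet> n = 0" "b \<bullet> n = 0"
  shows "(det3 a b n)\<^sup>2 = (a \<bullet> a) * (b \<bullet> b) - (a \<bullet> b)\<^sup>2"
  using det3_mult_det3[of a b n a b n] assms
  by (simp add: power2_eq_square inner_commute)

lemma det3_orthonormal:
  fixes a b n x :: "real^3"
  assumes "a \<bullet> a = 1" "b \<bullet> b = 1" "n \<bullet> n = 1" "a \<bullet> b = 0" "a \<bullet> n = 0" "b \<bullet> n = 0"
  shows "(det3 a b n)\<^sup>2 = 1" "det3 a b x = det3 a b n * (x \<bullet> n)"
proof -
  show *: "(det3 a b n)\<^sup>2 = 1"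
    using det3_unit_normal[of n a b] assms by simp
  have "det3 a b n * det3 a b x = x \<bullet> n"
    using det3_mult_det3[of a b n a b x] assms by (simp add: inner_commute)
  then have "det3 a b n * (det3 a b n * det3 a b x) = det3 a b n * (x \<bullet> n)" by simp
  then show "det3 a b x = det3 a b n * (x \<bullet> n)"
    using * by (metis mult.assoc mult.left_neutral power2_eq_square)
qed

lemma det3_eq_cross3_inner: "det3 x y z = cross3 x y \<bullet> z"
  by (simp add: cross3_simps)

lemma det3_scale_shear:
  "det3 (c *\<^sub>R x) (p *\<^sub>R x + q *\<^sub>R y) z = c * q * det3 x y z"
  by (simp add: det3_eq_cross3_inner cross_add_right cross_mult_left cross_mult_right)

lemma det3_last:
  "det3 x y (u + v) = det3 x y u + det3 x y v" "det3 x y (k *\<^sub>R u) = k * det3 x y u"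
  "det3 x y x = 0" "det3 x y y = 0"
  by (simp_all add: det3_eq_cross3_inner inner_add_right dot_cross_self)

lemma norm_cross3_orthonormal:
  fixes x y :: "real^3"
  assumes "x \<bullet> x = 1" "y \<bullet> y = 1" "x \<bullet> y = 0"
  shows "norm (cross3 (c *\<^sub>R x) (p *\<^sub>R x + q *\<^sub>R y)) = \<bar>c * q\<bar>"
proof -
  have "norm x = 1" "norm y = 1" using assms by (simp_all add: norm_eq_1)
  then have "(norm (cross3 x y))\<^sup>2 = 1"
    using norm_cross_dot[of x y] assms by simp
  then have "norm (cross3 x y) = 1" using norm_ge_zero[of "cross3 x y"] by (auto simp: power2_eq_1_iff)
  moreover have "cross3 (c *\<^sub>R x) (p *\<^sub>R x + q *\<^sub>R y) = (c * q) *\<^sub>R cross3 x y"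
    by (simp add: cross_add_right cross_mult_left cross_mult_right)
  ultimately show ?thesis by simp
qed

section \<open>Frontals in orthogonal adapted coordinates\<close>

text \<open>Differentiation along the axis only sees the values on the axis.  Identities that hold for
  \<open>v = 0\<close> alone may therefore be differentiated in the direction of \<open>u\<close>.\<close>

lemma partial_1_cong_axis:
  assumes "open W" "smooth_on W h" "smooth_on W k" "w \<in> W" "w $ 2 = 0"
    and eq: "\<And>w. w \<in> W \<Longrightarrow> w $ 2 = 0 \<Longrightarrow> h w = k w"
  shows "partial 1 h w = partial 1 k w"
proof -
  define l :: "real \<Rightarrow> real^2" where "l = (\<lambda>t. w + t *\<^sub>R axis 1 1)"
  have l: "(l has_vector_derivative axis 1 1) (at t)" for t
    unfolding l_def by (rule line_has_vector_derivative)
  have D: "((\<lambda>t. h (l t)) has_vector_derivative partial 1 h w) (at 0)"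
    if "smooth_on W h" for h :: "real^2 \<Rightarrow> 'a"
  proof -
    have D: "(h has_derivative frechet_derivative h (at (l 0))) (at (l 0))"
      using that assms(4) by (intro smooth_on_has_derivative) (auto simp: l_def)
    show ?thesis
      using vector_derivative_diff_chain_within[OF l has_derivative_at_withinI[OF D]]
      by (simp add: o_def l_def partial_def dir_deriv_def)
  qed
  have "open (l -` W)"
    unfolding l_def by (intro open_vimage assms(1) continuous_intros)
  moreover have "0 \<in> l -` W" using assms(4) by (simp add: l_def)
  moreover have "h (l t) = k (l t)" if "t \<in> l -` W" for t
    using that assms(5) by (intro eq) (auto simp: l_def axis_def)
  ultimately have "((\<lambda>t. k (l t)) has_vector_derivative partial 1 h w) (at 0)"
    by (rule has_vector_derivative_transform_within_open[OF D[OF assms(2)]])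
  from vector_derivative_unique_at[OF this D[OF assms(3)]] show ?thesis .
qed

text \<open>The frontal expressed in orthogonal adapted coordinates; \<open>g\<close> and \<open>n\<close> play the roles of
  \<open>f \<circ> \<phi>\<close> and \<open>\<nu> \<circ> \<phi>\<close>.\<close>

locale orthogonal_adapted_frontal =
  fixes W :: "(real^2) set" and g n :: "real^2 \<Rightarrow> real^3"
  assumes W: "open W"
    and g: "smooth_on W g" and n: "smooth_on W n"
    and unit: "w \<in> W \<Longrightarrow> n w \<bullet> n w = 1"
    and normal: "w \<in> W \<Longrightarrow> partial i g w \<bullet> n w = 0"
    and gv: "w \<in> W \<Longrightarrow> w $ 2 = 0 \<Longrightarrow> partial 2 g w = 0"
    and gu_unit: "w \<in> W \<Longrightarrow> w $ 2 = 0 \<Longrightarrow> partial 1 g w \<bullet> partial 1 g w = 1"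
    and gvv_unit: "w \<in> W \<Longrightarrow> w $ 2 = 0 \<Longrightarrow> partial 2 (partial 2 g) w \<bullet> partial 2 (partial 2 g) w = 1"
    and gu_gvv: "w \<in> W \<Longrightarrow> w $ 2 = 0 \<Longrightarrow> partial 1 g w \<bullet> partial 2 (partial 2 g) w = 0"
begin

abbreviation "gu \<equiv> partial 1 g"
abbreviation "gv \<equiv> partial 2 g"
abbreviation "guu \<equiv> partial 1 (partial 1 g)"
abbreviation "guv \<equiv> partial 1 (partial 2 g)"
abbreviation "gvv \<equiv> partial 2 (partial 2 g)"
abbreviation "guvv \<equiv> partial 1 (partial 2 (partial 2 g))"
abbreviation "gvvv \<equiv> partial 2 (partial 2 (partial 2 g))"
abbreviation "nv \<equiv> partial 2 n"

definition "E w = gu w \<bullet> gu w"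
definition "F w = gu w \<bullet> gv w"
definition "G w = gv w \<bullet> gv w"
definition "L w = guu w \<bullet> n w"
definition "M w = guv w \<bullet> n w"
definition "N w = gvv w \<bullet> n w"

lemma smooth: "smooth_on W E" "smooth_on W F" "smooth_on W G" "smooth_on W L" "smooth_on W M" "smooth_on W N"
  unfolding E_def[abs_def] F_def[abs_def] G_def[abs_def] L_def[abs_def] M_def[abs_def] N_def[abs_def]
  by (intro smooth_on_intros W g n)+

lemma partial_1_zero_axis:
  assumes "smooth_on W h" "\<And>w. w \<in> W \<Longrightarrow> w $ 2 = 0 \<Longrightarrow> h w = 0" "w \<in> W" "w $ 2 = 0"
  shows "partial 1 h w = 0"
  using partial_1_cong_axis[OF W assms(1) smooth_on_const assms(3,4), of 0] assms(2)
  by (simp add: partial_const)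

lemma guv: "w \<in> W \<Longrightarrow> w $ 2 = 0 \<Longrightarrow> guv w = 0"
  by (rule partial_1_zero_axis) (auto intro: gv smooth_on_partial g)

lemma gvu: "w \<in> W \<Longrightarrow> w $ 2 = 0 \<Longrightarrow> partial 2 gu w = 0"
  using guv partial_commute[OF W g, of w 2 1] by simp

lemma partial_zero:
  assumes "\<And>w. w \<in> W \<Longrightarrow> h w = 0" "w \<in> W"
  shows "partial i h w = 0"
  using partial_cong_open[where f=h and g="\<lambda>_. 0" and i=i, OF W assms] by (simp add: partial_const)

lemma normal_v: "w \<in> W \<Longrightarrow> gv w \<bullet> nv w + gvv w \<bullet> n w = 0"
  using partial_zero[of "\<lambda>w. gv w \<bullet> n w" w 2] normal
    partial_inner[OF smooth_on_partial[OF g] n, of w 2 2] by simp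

lemma gvv_n: "w \<in> W \<Longrightarrow> w $ 2 = 0 \<Longrightarrow> gvv w \<bullet> n w = 0"
  using normal_v[of w] gv[of w] by simp

text \<open>The factor 2 comes from differentiating \<open>g\<^sub>v \<bullet> n = 0\<close> twice in \<open>v\<close>, where the mixed term
  \<open>g\<^sub>v\<^sub>v \<bullet> n\<^sub>v\<close> occurs twice.\<close>

lemma gvvv_n:
  assumes "w \<in> W" "w $ 2 = 0"
  shows "gvvv w \<bullet> n w = - 2 * (gvv w \<bullet> nv w)"
proof -
  have "partial 2 (\<lambda>w. gv w \<bullet> nv w + gvv w \<bullet> n w) w = 0"
    using normal_v assms by (intro partial_zero)
  then show ?thesis
    using assms gv[OF assms]
    by (simp add: partial_add[of W] partial_inner[of W] smooth_on_intros W g n)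
qed

lemma partial_N:
  assumes "w \<in> W" "w $ 2 = 0"
  shows "partial 2 N w = - (gvv w \<bullet> nv w)" "gvvv w \<bullet> n w = 2 * partial 2 N w"
proof -
  have "partial 2 N w = gvv w \<bullet> nv w + gvvv w \<bullet> n w"
    unfolding N_def[abs_def] using assms by (simp add: partial_inner[of W] smooth_on_intros W g n)
  then show "partial 2 N w = - (gvv w \<bullet> nv w)" "gvvv w \<bullet> n w = 2 * partial 2 N w"
    using gvvv_n[OF assms] by simp_all
qed

lemma partial_M:
  assumes "w \<in> W" "w $ 2 = 0"
  shows "partial 2 M w = guvv w \<bullet> n w"
  unfolding M_def[abs_def] using assms guv[OF assms] partial_commute[OF W smooth_on_partial[OF g], of w 2 1 2]
  by (simp add: partial_inner[of W] smooth_on_intros W g n)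

lemmas frame = gu_unit gvv_unit unit gu_gvv normal gvv_n

text \<open>Since \<open>(g\<^sub>u, n, g\<^sub>v\<^sub>v)\<close> is orthonormal on the axis, the determinant is \<open>\<plusminus> g\<^sub>v\<^sub>v \<bullet> n\<^sub>v = \<mp> N\<^sub>v\<close>.\<close>

lemma partial_N_zero_iff_front_determinant:
  assumes "w \<in> W" "w $ 2 = 0" 
  shows "det3 (gu w) (n w) (nv w) = 0 \<longleftrightarrow> partial 2 N w = 0"
proof -
  have "(det3 (gu w) (n w) (gvv w))\<^sup>2 = 1" "det3 (gu w) (n w) (nv w) = det3 (gu w) (n w) (gvv w) * (nv w \<bullet> gvv w)"
    by (rule det3_orthonormal; use frame[OF assms(1)] assms in \<open>simp add: inner_commute\<close>)+
  then show ?thesis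
    using partial_N(1)[OF assms] by (auto simp: inner_commute)
qed

text \<open>With \<open>D = (E G - F\<^sup>2) / s\<^sup>2\<close> the function \<open>Q / s\<^sup>2\<close> becomes
  \<open>(E (N / s\<^sup>2) - 2 (F / s) (M / s) + (G / s\<^sup>2) L)\<^sup>2 / D - 4 (L (N / s\<^sup>2) - (M / s)\<^sup>2)\<close>, in which every
  quotient converges along the line.  If \<open>\<sigma>\<close> denotes the limit of \<open>N / s\<^sup>2\<close>, the result is
  \<open>(\<sigma> + L)\<^sup>2 - 4 L \<sigma> + 4 M\<^sub>v\<^sup>2 = (\<sigma> - L)\<^sup>2 + 4 M\<^sub>v\<^sup>2\<close>, a sum of squares.\<close>

lemma Gamma_second_order:
  assumes w: "w \<in> W" "w $ 2 = 0" and Nv: "partial 2 N w = 0"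
    and Q: "\<And>w. w \<in> W \<Longrightarrow> w $ 2 \<noteq> 0 \<Longrightarrow>
        Q w = 4 * (area_density g n w)\<^sup>2 * ((mean_curvature g n w)\<^sup>2 - gaussian_curvature g n w)"
  shows "((\<lambda>s. Q (w + s *\<^sub>R vector [a, 1]) / s\<^sup>2) \<longlongrightarrow>
     (partial 1 (partial 2 N) w * a + (partial 2 (partial 2 N) w / 2 - L w))\<^sup>2 + 4 * (partial 2 M w)\<^sup>2) (at 0)"
proof -
  define z where "z = (vector [a, 1] :: real^2)"
  define x where "x s = w + s *\<^sub>R z" for s
  note lim = zeroth_order_along_line[of W _ w z, folded x_def] first_order_along_line[of W _ w z, folded x_def]
    second_order_along_line[OF W, of _ w z, folded x_def]
  have z: "z $ 1 = a" "z $ 2 = 1" by (simp_all add: z_def)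
  have zero: "F w = 0" "G w = 0" "M w = 0" "N w = 0"
    "partial 1 F w = 0" "partial 1 G w = 0" "partial 1 M w = 0" "partial 1 N w = 0"
    using w by (auto intro!: partial_1_zero_axis smooth simp: F_def G_def M_def N_def gv guv gvv_n)
  have Fv: "partial 2 F w = 0"
    unfolding F_def[abs_def] using w gv[OF w] gu_gvv[OF w] 
    by (simp add: partial_inner[of W] smooth_on_intros W g)
  have Gv: "partial 2 G w = 2 * (gvv w \<bullet> gv w)" if "w \<in> W" for w
    unfolding G_def[abs_def] using that
    by (simp add: partial_inner[of W] smooth_on_intros W g inner_commute)
  have Gv0: "partial 2 G w = 0" using Gv[OF w(1)] gv[OF w] by simp
  have "partial 1 (partial 2 G) w = 0"
    by (rule partial_1_zero_axis[OF _ _ w]) (auto simp: Gv gv intro: smooth_on_partial smooth)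
  moreover have "partial 1 (partial 1 G) w = 0"
    by (rule partial_1_zero_axis[OF _ _ w])
      (auto intro!: smooth_on_partial smooth partial_1_zero_axis simp: G_def gv)
  moreover have "partial 2 (partial 2 G) w = 2"
  proof -
    have "partial 2 (partial 2 G) w = partial 2 (\<lambda>w. 2 * (gvv w \<bullet> gv w)) w"
      by (rule partial_cong_open[OF W Gv w(1)])
    also have "\<dots> = 2"
      using w gvv_unit[OF w] gv[OF w]
      by (simp add: partial_inner[of W] partial_mult[of W] smooth_on_intros W g partial_const)
    finally show ?thesis .
  qed
  ultimately have G: "((\<lambda>s. G (x s) / s\<^sup>2) \<longlongrightarrow> 1) (at 0)"
    using lim(3)[OF smooth(3) w(1)] zero Gv0 by (simp add: hessian_form_def z)
  have "partial 1 (partial 1 N) w = 0"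
    by (rule partial_1_zero_axis[OF _ _ w])
      (auto intro!: smooth_on_partial smooth partial_1_zero_axis simp: N_def gvv_n)
  then have N: "((\<lambda>s. N (x s) / s\<^sup>2) \<longlongrightarrow> partial 1 (partial 2 N) w * a + partial 2 (partial 2 N) w / 2) (at 0)"
    using lim(3)[OF smooth(6) w(1)] zero Nv by (simp add: hessian_form_def z add_divide_distrib mult.commute)
  have E: "((\<lambda>s. E (x s)) \<longlongrightarrow> 1) (at 0)"
    using lim(1)[OF smooth(1) w(1)] gu_unit[OF w] by (simp add: E_def)
  have L: "((\<lambda>s. L (x s)) \<longlongrightarrow> L w) (at 0)"
    by (rule lim(1)[OF smooth(4) w(1)])
  have F: "((\<lambda>s. F (x s) / s) \<longlongrightarrow> 0) (at 0)"
    using lim(2)[OF smooth(2) w(1)] zero Fv by simp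
  have M: "((\<lambda>s. M (x s) / s) \<longlongrightarrow> partial 2 M w) (at 0)"
    using lim(2)[OF smooth(5) w(1)] zero by (simp add: z)
  define D where "D s = E (x s) * (G (x s) / s\<^sup>2) - (F (x s) / s)\<^sup>2" for s
  have D: "(D \<longlongrightarrow> 1) (at 0)"
    unfolding D_def using tendsto_diff[OF tendsto_mult[OF E G] tendsto_power[OF F, of 2]] by simp
  have "((\<lambda>s. (E (x s) * (N (x s) / s\<^sup>2) - 2 * (F (x s) / s) * (M (x s) / s) + (G (x s) / s\<^sup>2) * L (x s))\<^sup>2 / D s
       - 4 * (L (x s) * (N (x s) / s\<^sup>2) - (M (x s) / s)\<^sup>2)) \<longlongrightarrow>
      (1 * (partial 1 (partial 2 N) w * a + partial 2 (partial 2 N) w / 2) - 2 * 0 * partial 2 M w + 1 * L w)\<^sup>2 / 1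
       - 4 * (L w * (partial 1 (partial 2 N) w * a + partial 2 (partial 2 N) w / 2) - (partial 2 M w)\<^sup>2)) (at 0)"
    by (intro tendsto_intros E F G L M N D) simp
  also have "(1 * (partial 1 (partial 2 N) w * a + partial 2 (partial 2 N) w / 2) - 2 * 0 * partial 2 M w + 1 * L w)\<^sup>2 / 1
       - 4 * (L w * (partial 1 (partial 2 N) w * a + partial 2 (partial 2 N) w / 2) - (partial 2 M w)\<^sup>2)
    = (partial 1 (partial 2 N) w * a + (partial 2 (partial 2 N) w / 2 - L w))\<^sup>2 + 4 * (partial 2 M w)\<^sup>2"
    by (simp add: power2_eq_square algebra_simps)
  finally show ?thesis
  proof (rule Lim_transform_eventually)
    have "((\<lambda>s. x s) \<longlongrightarrow> w) (at 0)"
      unfolding x_def by (rule tendsto_eq_intros refl)+ simp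
    then have "\<forall>\<^sub>F s in at 0. x s \<in> W"
      using W w(1) by (rule topological_tendstoD)
    moreover have "\<forall>\<^sub>F s in at 0. D s > 0"
      using order_tendstoD(1)[OF D, of 0] by simp
    moreover have "\<forall>\<^sub>F s in at (0::real). s \<noteq> 0"
      by (simp add: eventually_at_filter)
    ultimately show "\<forall>\<^sub>F s in at 0.
      (E (x s) * (N (x s) / s\<^sup>2) - 2 * (F (x s) / s) * (M (x s) / s) + (G (x s) / s\<^sup>2) * L (x s))\<^sup>2 / D s
       - 4 * (L (x s) * (N (x s) / s\<^sup>2) - (M (x s) / s)\<^sup>2) = Q (w + s *\<^sub>R vector [a, 1]) / s\<^sup>2"
    proof eventually_elim
      case (elim s)
      let ?e = "E (x s)" and ?f = "F (x s)" and ?g = "G (x s)" and ?l = "L (x s)" and ?m = "M (x s)" and ?n = "N (x s)"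
      have "x s $ 2 = s" using w by (simp add: x_def z)
      then have "Q (x s) = 4 * (area_density g n (x s))\<^sup>2 *
          ((mean_curvature g n (x s))\<^sup>2 - gaussian_curvature g n (x s))"
        using elim by (intro Q) auto
      also have "(area_density g n (x s))\<^sup>2 = ?e * ?g - ?f\<^sup>2"
        unfolding area_density_def E_def F_def G_def using elim
        by (intro det3_unit_normal unit normal)
      also have "mean_curvature g n (x s) = (?e * ?n - 2 * ?f * ?m + ?g * ?l) / (2 * (?e * ?g - ?f\<^sup>2))"
        by (simp add: mean_curvature_def Let_def E_def F_def G_def L_def M_def N_def)
      also have "gaussian_curvature g n (x s) = (?l * ?n - ?m\<^sup>2) / (?e * ?g - ?f\<^sup>2)"
        by (simp add: gaussian_curvature_def Let_def E_def F_def G_def L_def M_def N_def)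
      finally have Qx: "Q (x s) = 4 * (?e * ?g - ?f\<^sup>2) *
         (((?e * ?n - 2 * ?f * ?m + ?g * ?l) / (2 * (?e * ?g - ?f\<^sup>2)))\<^sup>2 - (?l * ?n - ?m\<^sup>2) / (?e * ?g - ?f\<^sup>2))" .
      define d where "d = ?e * ?g - ?f\<^sup>2"
      have d: "D s = d / s\<^sup>2" "d \<noteq> 0"
        using elim by (auto simp: D_def d_def field_simps power2_eq_square)
      have "Q (x s) / s\<^sup>2 = ((?e * ?n - 2 * ?f * ?m + ?g * ?l)\<^sup>2 / d - 4 * (?l * ?n - ?m\<^sup>2)) / s\<^sup>2"
      proof -
        have "4 * d * ((X / (2 * d))\<^sup>2 - Y / d) = X\<^sup>2 / d - 4 * Y" for X Y :: real
          using d(2) by (simp add: field_simps power2_eq_square)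
        then show ?thesis unfolding Qx d_def[symmetric] by presburger
      qed
      also have "\<dots> = ((?e * ?n - 2 * ?f * ?m + ?g * ?l) / s\<^sup>2)\<^sup>2 / (d / s\<^sup>2) - 4 * ((?l * ?n - ?m\<^sup>2) / s\<^sup>2)"
        using elim d(2) by (simp add: field_simps power2_eq_square)
      also have "(?e * ?n - 2 * ?f * ?m + ?g * ?l) / s\<^sup>2 = ?e * (?n / s\<^sup>2) - 2 * (?f / s) * (?m / s) + (?g / s\<^sup>2) * ?l"
        using elim by (simp add: field_simps power2_eq_square)
      also have "(?l * ?n - ?m\<^sup>2) / s\<^sup>2 = ?l * (?n / s\<^sup>2) - (?m / s)\<^sup>2"
        using elim by (simp add: field_simps power2_eq_square)
      finally show ?case using d(1) by (simp add: x_def z_def)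
    qed
  qed
qed

section \<open>Null fields and cuspidal invariants in adapted coordinates\<close>

text \<open>A null vector field \<open>Y\<close> is a combination \<open>a \<partial>\<^sub>u + b \<partial>\<^sub>v\<close> with \<open>a = 0\<close> on the axis, so that each
  further derivative along \<open>Y\<close> adds, besides multiples of vectors already present, only a power of
  \<open>b\<close> times the corresponding \<open>v\<close>-derivative.\<close>

lemma null_field_derivatives:
  fixes Y :: "real^2 \<Rightarrow> real^2"
  assumes Y: "smooth_on W Y" and null: "\<forall>w\<in>W. w $ 2 = 0 \<longrightarrow> Y w $ 1 = 0"
    and P: "P = (\<lambda>w. Y w $ 1 *\<^sub>R gu w + Y w $ 2 *\<^sub>R gv w)"
    and R: "R = (\<lambda>w. Y w $ 1 *\<^sub>R partial 1 P w + Y w $ 2 *\<^sub>R partial 2 P w)"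
    and w: "w \<in> W" "w $ 2 = 0"
  shows "smooth_on W P" "smooth_on W R"
    and "R w = (Y w $ 2 * partial 2 (\<lambda>w. Y w $ 1) w) *\<^sub>R gu w + (Y w $ 2)\<^sup>2 *\<^sub>R gvv w"
    and "\<exists>r t. Y w $ 1 *\<^sub>R partial 1 R w + Y w $ 2 *\<^sub>R partial 2 R w = r *\<^sub>R gu w + t *\<^sub>R gvv w + (Y w $ 2) ^ 3 *\<^sub>R gvvv w"
proof -
  define a b where "a = (\<lambda>w. Y w $ 1)" and "b = (\<lambda>w. Y w $ 2)"
  have ab: "smooth_on W a" "smooth_on W b"
    unfolding a_def b_def by (intro smooth_on_intros W Y)+
  have P_def: "P = (\<lambda>w. a w *\<^sub>R gu w + b w *\<^sub>R gv w)"
    and R_def: "R = (\<lambda>w. a w *\<^sub>R partial 1 P w + b w *\<^sub>R partial 2 P w)"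
    by (simp_all add: P R a_def b_def)
  note sm = smooth_on_intros W g ab
  show P: "smooth_on W P" unfolding P_def by (intro sm)
  show "smooth_on W R" unfolding R_def by (intro sm P)
  have a0: "a w = 0" "partial 1 a w = 0" if "w \<in> W" "w $ 2 = 0" for w
    using that null partial_1_zero_axis[OF ab(1), of w] by (auto simp: a_def)
  have dP: "partial 2 P w = a w *\<^sub>R partial 2 gu w + partial 2 a w *\<^sub>R gu w
      + (b w *\<^sub>R gvv w + partial 2 b w *\<^sub>R gv w)" if "w \<in> W" for w
    unfolding P_def using that by (simp add: partial_add[of W] partial_scaleR[of W] sm)
  have P0: "P w = 0" if "w \<in> W" "w $ 2 = 0" for w
    using that a0 gv by (simp add: P_def)
  then have P1: "partial 1 P w = 0" if "w \<in> W" "w $ 2 = 0" for w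
    using that by (intro partial_1_zero_axis P) auto
  show "R w = (Y w $ 2 * partial 2 (\<lambda>w. Y w $ 1) w) *\<^sub>R gu w + (Y w $ 2)\<^sup>2 *\<^sub>R gvv w"
    unfolding a_def[symmetric] using w a0 gv
    by (simp add: R_def P1 dP power2_eq_square scaleR_add_right) (simp add: b_def)
  have "partial 2 R w = a w *\<^sub>R partial 2 (partial 1 P) w + partial 2 a w *\<^sub>R partial 1 P w
      + (b w *\<^sub>R partial 2 (partial 2 P) w + partial 2 b w *\<^sub>R partial 2 P w)"
    unfolding R_def using w by (simp add: partial_add[of W] partial_scaleR[of W] sm P)
  moreover have "partial 2 (partial 2 P) w =
      partial 2 (\<lambda>w. a w *\<^sub>R partial 2 gu w + partial 2 a w *\<^sub>R gu w
        + (b w *\<^sub>R gvv w + partial 2 b w *\<^sub>R gv w)) w"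
    by (rule partial_cong_open[OF W dP w(1)])
  moreover have "\<dots> = partial 2 (partial 2 a) w *\<^sub>R gu w + (2 * partial 2 b w) *\<^sub>R gvv w + b w *\<^sub>R gvvv w"
    using w a0[OF w] gv[OF w] gvu[OF w]
    by (simp add: partial_add[of W] partial_scaleR[of W] sm algebra_simps flip: scaleR_2)
  ultimately have "a w *\<^sub>R partial 1 R w + b w *\<^sub>R partial 2 R w
    = (b w * (b w * partial 2 (partial 2 a) w + partial 2 b w * partial 2 a w)) *\<^sub>R gu w
    + (3 * (b w)\<^sup>2 * partial 2 b w) *\<^sub>R gvv w + (b w) ^ 3 *\<^sub>R gvvv w"
    using a0[OF w] P1[OF w] gv[OF w] dP[OF w(1)]
    by (simp add: power2_eq_square power3_eq_cube algebra_simps flip: scaleR_add_left)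
  then show "\<exists>r t. Y w $ 1 *\<^sub>R partial 1 R w + Y w $ 2 *\<^sub>R partial 2 R w = r *\<^sub>R gu w + t *\<^sub>R gvv w + (Y w $ 2) ^ 3 *\<^sub>R gvvv w"
    unfolding a_def b_def by blast
qed

lemma dir_deriv_dir_deriv:
  assumes "smooth_on W h" "w \<in> W"
  shows "dir_deriv X (dir_deriv Y h) w = dir_deriv X (\<lambda>w. Y w $ 1 *\<^sub>R partial 1 h w + Y w $ 2 *\<^sub>R partial 2 h w) w"
  by (rule dir_deriv_cong_open[OF W dir_deriv_eq_partial[OF assms(1)] assms(2)])

context
  fixes X Y :: "real^2 \<Rightarrow> real^2"
  assumes X: "smooth_on W X" and tangent: "\<And>w. w \<in> W \<Longrightarrow> w $ 2 = 0 \<Longrightarrow> X w $ 2 = 0"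
    and Y: "smooth_on W Y" and null: "\<forall>w\<in>W. w $ 2 = 0 \<longrightarrow> Y w $ 1 = 0"
    and oriented: "\<And>w. w \<in> W \<Longrightarrow> w $ 2 = 0 \<Longrightarrow> X w $ 1 * Y w $ 2 > 0"
begin

text \<open>With \<open>c\<close> and \<open>b\<close> the components of \<open>X\<close> and \<open>Y\<close> on the axis, the numerator carries the factor
  \<open>c b\<^sup>5\<close> and the remaining norms give \<open>\<bar>c\<bar>\<^sup>-\<^sup>1 \<bar>b\<bar>\<^sup>-\<^sup>5\<close>.  Positive orientation makes these cancel.\<close>

lemma cuspidal_curvature_axis:
  assumes w: "w \<in> W" "w $ 2 = 0"
  shows "cuspidal_curvature g X Y w = det3 (gu w) (gvv w) (gvvv w)"
proof -
  define P where "P = (\<lambda>w. Y w $ 1 *\<^sub>R gu w + Y w $ 2 *\<^sub>R gv w)"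
  define R where "R = (\<lambda>w. Y w $ 1 *\<^sub>R partial 1 P w + Y w $ 2 *\<^sub>R partial 2 P w)"
  define c b where "c = X w $ 1" and "b = Y w $ 2"
  note nf = null_field_derivatives[OF Y null P_def R_def w]
  have 1: "dir_deriv X g w = c *\<^sub>R gu w"
    using dir_deriv_eq_partial[OF g w(1)] tangent[OF w] by (simp add: c_def)
  have YYg: "dir_deriv Y (dir_deriv Y g) w = R w" if "w \<in> W" for w
    using dir_deriv_dir_deriv[OF g that] dir_deriv_eq_partial[OF nf(1) that]
    by (simp add: P_def[symmetric] R_def)
  have "dir_deriv Y (dir_deriv Y (dir_deriv Y g)) w = dir_deriv Y R w"
    by (rule dir_deriv_cong_open[OF W YYg w(1)])
  also have "\<dots> = Y w $ 1 *\<^sub>R partial 1 R w + Y w $ 2 *\<^sub>R partial 2 R w"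
    by (rule dir_deriv_eq_partial[OF nf(2) w(1)])
  finally obtain r t where 3: "dir_deriv Y (dir_deriv Y (dir_deriv Y g)) w = r *\<^sub>R gu w + t *\<^sub>R gvv w + b ^ 3 *\<^sub>R gvvv w"
    using nf(4) unfolding b_def[symmetric] by (elim exE) simp
  define p where "p = Y w $ 2 * partial 2 (\<lambda>w. Y w $ 1) w"
  have 2: "dir_deriv Y (dir_deriv Y g) w = p *\<^sub>R gu w + b\<^sup>2 *\<^sub>R gvv w"
    unfolding p_def b_def using YYg[OF w(1)] nf(3) by (rule trans)
  have cb: "c * b > 0" using oriented[OF w] by (simp add: c_def b_def)
  then have "c \<noteq> 0" "b \<noteq> 0" by auto
  have "norm (gu w) = 1" using gu_unit[OF w] by (simp add: norm_eq_1)
  then have "norm (dir_deriv X g w) = \<bar>c\<bar>" by (simp add: 1)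
  moreover have "norm (cross3 (dir_deriv X g w) (dir_deriv Y (dir_deriv Y g) w)) = \<bar>c\<bar> * b\<^sup>2"
    unfolding 1 2 using gu_unit[OF w] gvv_unit[OF w] gu_gvv[OF w]
    by (subst norm_cross3_orthonormal) (auto simp: abs_mult)
  moreover have "(\<bar>c\<bar> * b\<^sup>2) powr (5/2) = \<bar>c\<bar> powr (3/2) * (c * b ^ 5)"
  proof -
    have "\<bar>c\<bar> powr (5/2) = \<bar>c\<bar> powr (3/2) * \<bar>c\<bar>"
      using \<open>c \<noteq> 0\<close> powr_add[of "\<bar>c\<bar>" "3/2" 1] by simp
    moreover have "(b\<^sup>2) powr (5/2) = \<bar>b\<bar> ^ 5"
    proof -
      have "\<bar>b\<bar> powr 2 = b\<^sup>2" "\<bar>b\<bar> powr 5 = \<bar>b\<bar> ^ 5"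
        using \<open>b \<noteq> 0\<close> by (simp_all add: powr_numeral)
      then show ?thesis
        using powr_powr[of "\<bar>b\<bar>" 2 "5/2"] by simp
    qed
    moreover have "\<bar>c\<bar> * \<bar>b\<bar> ^ 5 = c * b ^ 5"
    proof -
      have "\<bar>c\<bar> * \<bar>b\<bar> ^ 5 = \<bar>c * b\<bar> * (b\<^sup>2)\<^sup>2" by (simp add: abs_mult eval_nat_numeral)
      also have "\<dots> = c * b ^ 5" using cb by (simp add: eval_nat_numeral)
      finally show ?thesis .
    qed
    ultimately show ?thesis by (simp add: powr_mult mult.assoc)
  qed
  moreover have "det3 (dir_deriv X g w) (dir_deriv Y (dir_deriv Y g) w) (dir_deriv Y (dir_deriv Y (dir_deriv Y g)) w)
     = c * b ^ 5 * det3 (gu w) (gvv w) (gvvv w)"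
    unfolding 1 2 3 det3_scale_shear by (simp add: det3_last eval_nat_numeral)
  ultimately show ?thesis
    using \<open>c \<noteq> 0\<close> \<open>b \<noteq> 0\<close> by (simp add: cuspidal_curvature_def Let_def)
qed

text \<open>On the axis \<open>Y Y g = p g\<^sub>u + q g\<^sub>v\<^sub>v\<close>, and the subtracted term in the definition of the torsion is
  exactly the contribution \<open>(p / q) det (g\<^sub>u, g\<^sub>v\<^sub>v, g\<^sub>u\<^sub>u)\<close> of the tangential part \<open>p g\<^sub>u\<close>.\<close>

lemma cuspidal_torsion_axis:
  assumes w: "w \<in> W" "w $ 2 = 0"
  shows "cuspidal_torsion g X Y w = det3 (gu w) (gvv w) (guvv w)"
proof -
  define P where "P = (\<lambda>w. Y w $ 1 *\<^sub>R gu w + Y w $ 2 *\<^sub>R gv w)"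
  define R where "R = (\<lambda>w. Y w $ 1 *\<^sub>R partial 1 P w + Y w $ 2 *\<^sub>R partial 2 P w)"
  define c where "c = (\<lambda>w. X w $ 1)"
  define p q where "p = (\<lambda>w. Y w $ 2 * partial 2 (\<lambda>w. Y w $ 1) w)" and "q = (\<lambda>w. (Y w $ 2)\<^sup>2)"
  note nf = null_field_derivatives[OF Y null P_def R_def]
  have pq: "smooth_on W p" "smooth_on W q" and c: "smooth_on W c"
    unfolding p_def q_def c_def power2_eq_square by (intro smooth_on_intros W Y X)+
  note sm = smooth_on_intros W g pq c
  have Xg: "dir_deriv X h w = c w *\<^sub>R partial 1 h w" if "smooth_on W h" for h :: "real^2 \<Rightarrow> real^3"
    using dir_deriv_eq_partial[OF that w(1)] tangent[OF w] by (simp add: c_def)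
  have YYg: "dir_deriv Y (dir_deriv Y g) w = R w" if "w \<in> W" for w
    using dir_deriv_dir_deriv[OF g that] dir_deriv_eq_partial[OF nf(1)[OF w] that]
    by (simp add: P_def[symmetric] R_def)
  have R: "R w = p w *\<^sub>R gu w + q w *\<^sub>R gvv w" if "w \<in> W" "w $ 2 = 0" for w
    using nf(3)[OF that] by (simp add: p_def q_def)
  have "dir_deriv X (dir_deriv Y (dir_deriv Y g)) w = dir_deriv X R w"
    by (rule dir_deriv_cong_open[OF W YYg w(1)])
  also have "\<dots> = c w *\<^sub>R partial 1 R w"
    by (rule Xg[OF nf(2)[OF w]])
  also have "partial 1 R w = partial 1 (\<lambda>w. p w *\<^sub>R gu w + q w *\<^sub>R gvv w) w"
    by (intro partial_1_cong_axis[OF W nf(2)[OF w] _ w R] sm)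
  also have "\<dots> = p w *\<^sub>R guu w + partial 1 p w *\<^sub>R gu w + (q w *\<^sub>R guvv w + partial 1 q w *\<^sub>R gvv w)"
    using w by (simp add: partial_add[of W] partial_scaleR[of W] sm)
  finally have XYYg: "dir_deriv X (dir_deriv Y (dir_deriv Y g)) w =
     c w *\<^sub>R (p w *\<^sub>R guu w + partial 1 p w *\<^sub>R gu w + (q w *\<^sub>R guvv w + partial 1 q w *\<^sub>R gvv w))" .
  have "dir_deriv X (dir_deriv X g) w = dir_deriv X (\<lambda>w. X w $ 1 *\<^sub>R gu w + X w $ 2 *\<^sub>R gv w) w"
    by (rule dir_deriv_dir_deriv[OF g w(1)])
  also have "\<dots> = c w *\<^sub>R partial 1 (\<lambda>w. X w $ 1 *\<^sub>R gu w + X w $ 2 *\<^sub>R gv w) w"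
    by (intro Xg sm X)
  also have "partial 1 (\<lambda>w. X w $ 1 *\<^sub>R gu w + X w $ 2 *\<^sub>R gv w) w = partial 1 (\<lambda>w. c w *\<^sub>R gu w) w"
    by (rule partial_1_cong_axis[OF W _ _ w]) (auto intro!: sm X simp: c_def gv)
  also have "\<dots> = c w *\<^sub>R guu w + partial 1 c w *\<^sub>R gu w"
    using w by (simp add: partial_scaleR[of W] sm)
  finally have XXg: "dir_deriv X (dir_deriv X g) w = c w *\<^sub>R (c w *\<^sub>R guu w + partial 1 c w *\<^sub>R gu w)" .
  have "c w \<noteq> 0" "q w \<noteq> 0"
    using oriented[OF w] by (auto simp: c_def q_def)
  moreover have "norm (gu w) = 1" using gu_unit[OF w] by (simp add: norm_eq_1)
  moreover have "norm (cross3 (c w *\<^sub>R gu w) (p w *\<^sub>R gu w + q w *\<^sub>R gvv w)) = \<bar>c w * q w\<bar>"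
    using gu_unit[OF w] gvv_unit[OF w] gu_gvv[OF w] by (rule norm_cross3_orthonormal)
  moreover have "(c w *\<^sub>R gu w) \<bullet> (p w *\<^sub>R gu w + q w *\<^sub>R gvv w) = c w * p w"
    using gu_unit[OF w] gu_gvv[OF w] by (simp add: inner_add_right)
  moreover have "det3 (c w *\<^sub>R gu w) (p w *\<^sub>R gu w + q w *\<^sub>R gvv w) (c w *\<^sub>R (c w *\<^sub>R guu w + partial 1 c w *\<^sub>R gu w))
      = (c w) ^ 3 * q w * det3 (gu w) (gvv w) (guu w)"
    unfolding det3_scale_shear by (simp add: det3_last eval_nat_numeral)
  moreover have "det3 (c w *\<^sub>R gu w) (p w *\<^sub>R gu w + q w *\<^sub>R gvv w)
       (c w *\<^sub>R (p w *\<^sub>R guu w + partial 1 p w *\<^sub>R gu w + (q w *\<^sub>R guvv w + partial 1 q w *\<^sub>R gvv w)))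
      = (c w)\<^sup>2 * q w * (p w * det3 (gu w) (gvv w) (guu w) + q w * det3 (gu w) (gvv w) (guvv w))"
    unfolding det3_scale_shear by (simp add: det3_last eval_nat_numeral)
  ultimately show ?thesis
    unfolding cuspidal_torsion_def Let_def XYYg XXg YYg[OF w(1)] R[OF w] Xg[OF g]
    by (simp add: power_mult_distrib) (simp add: field_simps eval_nat_numeral)
qed

end

end


section \<open>Vector fields under a change of coordinates\<close>

lemma smooth_on_dir_deriv:
  assumes "open S" "smooth_on S X" "smooth_on S h"
  shows "smooth_on S (dir_deriv X h)"
proof (rule smooth_on_cong[OF assms(1)])
  show "smooth_on S (\<lambda>x. X x $ 1 *\<^sub>R partial 1 h x + X x $ 2 *\<^sub>R partial 2 h x)"
    by (intro smooth_on_intros assms)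
qed (simp add: dir_deriv_eq_partial[OF assms(3)])

lemma smooth_on_frechet_derivative_apply:
  fixes h :: "real^2 \<Rightarrow> real^2"
  assumes "open W" "smooth_on U h" "smooth_on W k" "k ` W \<subseteq> U" "smooth_on W X"
  shows "smooth_on W (\<lambda>w. frechet_derivative h (at (k w)) (X w))"
proof (rule smooth_on_cong[OF assms(1)])
  show "smooth_on W (\<lambda>w. X w $ 1 *\<^sub>R partial 1 h (k w) + X w $ 2 *\<^sub>R partial 2 h (k w))"
    by (intro smooth_on_add smooth_on_scaleR smooth_on_nth assms(1,5)
        smooth_on_compose[OF assms(1) smooth_on_partial[OF assms(2)] assms(3,4)])
  show "X w $ 1 *\<^sub>R partial 1 h (k w) + X w $ 2 *\<^sub>R partial 2 h (k w) = frechet_derivative h (at (k w)) (X w)"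
    if "w \<in> W" for w
    using that assms(4)
    by (subst frechet_derivative_at[OF has_derivative_partial[OF assms(2)], symmetric]) auto
qed

lemma det2_comb:
  "det2 (a *\<^sub>R x + b *\<^sub>R y) (c *\<^sub>R x + d *\<^sub>R y) = det2 x y * (a * d - b * c)"
  by (simp add: det_2 algebra_simps)

locale coordinate_change =
  fixes U W :: "(real^2) set" and \<phi> \<theta> :: "real^2 \<Rightarrow> real^2"
  assumes coordinates: "coordinate_system U W \<phi> \<theta>"
begin

lemma U: "open U" and W: "open W" and \<phi>: "smooth_on W \<phi>" and \<theta>: "smooth_on U \<theta>"
  and \<phi>_image: "\<phi> ` W = U" and \<theta>_image: "\<theta> ` U = W"
  and \<theta>_\<phi>: "w \<in> W \<Longrightarrow> \<theta> (\<phi> w) = w" and \<phi>_\<theta>: "q \<in> U \<Longrightarrow> \<phi> (\<theta> q) = q"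
  using coordinates by (auto simp: coordinate_system_def homeomorphism_def)

lemma \<phi>_in: "w \<in> W \<Longrightarrow> \<phi> w \<in> U" and \<theta>_in: "q \<in> U \<Longrightarrow> \<theta> q \<in> W"
  using \<phi>_image \<theta>_image by auto

lemma smooth_compose: "smooth_on U h \<Longrightarrow> smooth_on W (h \<circ> \<phi>)"
  unfolding o_def using smooth_on_compose[OF W _ \<phi>] \<phi>_image by blast

text \<open>The two components of \<open>pullback X w\<close> are the coefficients of \<open>X (\<phi> w)\<close> with respect to the
  coordinate fields \<open>\<partial>\<^sub>u \<phi>, \<partial>\<^sub>v \<phi>\<close>.\<close>

definition pullback :: "(real^2 \<Rightarrow> real^2) \<Rightarrow> real^2 \<Rightarrow> real^2" where
  "pullback X w = frechet_derivative \<theta> (at (\<phi> w)) (X (\<phi> w))"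

lemma smooth_pullback: "smooth_on U X \<Longrightarrow> smooth_on W (pullback X)"
  unfolding pullback_def[abs_def]
  using smooth_on_frechet_derivative_apply[OF W \<theta> \<phi> _ smooth_compose] \<phi>_image by (auto simp: o_def)

text \<open>The inverse \<open>\<theta>\<close> exhibits \<open>h\<close> as \<open>(h \<circ> \<phi>) \<circ> \<theta>\<close> on the open set \<open>U\<close>.\<close>

lemma frechet_derivative_compose:
  assumes "smooth_on U h" "w \<in> W"
  shows "frechet_derivative h (at (\<phi> w)) x =
    frechet_derivative (h \<circ> \<phi>) (at w) (frechet_derivative \<theta> (at (\<phi> w)) x)"
proof -
  have "((h \<circ> \<phi>) has_derivative frechet_derivative (h \<circ> \<phi>) (at w)) (at w)"
    by (rule smooth_on_has_derivative[OF smooth_compose[OF assms(1)] assms(2)])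
  then have "((\<lambda>q. (h \<circ> \<phi>) (\<theta> q)) has_derivative
      (\<lambda>x. frechet_derivative (h \<circ> \<phi>) (at w) (frechet_derivative \<theta> (at (\<phi> w)) x))) (at (\<phi> w))"
    using smooth_on_has_derivative[OF \<theta> \<phi>_in[OF assms(2)]] \<theta>_\<phi>[OF assms(2)]
    by (intro has_derivative_compose[where f = \<theta> and g = "h \<circ> \<phi>"]) (simp_all only:)
  then have "(h has_derivative
      (\<lambda>x. frechet_derivative (h \<circ> \<phi>) (at w) (frechet_derivative \<theta> (at (\<phi> w)) x))) (at (\<phi> w))"
    by (rule has_derivative_transform_within_open[OF _ U \<phi>_in[OF assms(2)]]) (simp add: \<phi>_\<theta>)
  then show ?thesis by (simp add: frechet_derivative_at[symmetric])
qed

lemma frechet_derivative_\<phi>_\<theta>: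
  assumes "w \<in> W"
  shows "frechet_derivative \<phi> (at w) (frechet_derivative \<theta> (at (\<phi> w)) x) = x"
proof -
  have "smooth_on U (\<lambda>q. q)"
    by (rule smooth_on_linear[OF bounded_linear_ident])
  moreover have "frechet_derivative (\<lambda>q. q) (at (\<phi> w)) x = x"
    by simp
  ultimately show ?thesis
    using frechet_derivative_compose[OF _ assms, of "\<lambda>q. q" x] by (simp add: o_def)
qed

lemma dir_deriv_pullback:
  assumes "smooth_on U h" "w \<in> W"
  shows "dir_deriv X h (\<phi> w) = dir_deriv (pullback X) (h \<circ> \<phi>) w"
  unfolding dir_deriv_def pullback_def by (rule frechet_derivative_compose[OF assms])

lemma dir_deriv_twice_pullback:
  assumes "smooth_on U h" "smooth_on U Y" "w \<in> W"
  shows "dir_deriv X (dir_deriv Y h) (\<phi> w) = dir_deriv (pullback X) (dir_deriv (pullback Y) (h \<circ> \<phi>)) w"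
proof -
  have "dir_deriv X (dir_deriv Y h) (\<phi> w) = dir_deriv (pullback X) (dir_deriv Y h \<circ> \<phi>) w"
    by (rule dir_deriv_pullback[OF smooth_on_dir_deriv[OF U assms(2,1)] assms(3)])
  also have "\<dots> = dir_deriv (pullback X) (dir_deriv (pullback Y) (h \<circ> \<phi>)) w"
    by (rule dir_deriv_cong_open[OF W _ assms(3)]) (simp add: dir_deriv_pullback[OF assms(1)])
  finally show ?thesis .
qed

lemma dir_deriv_thrice_pullback:
  assumes "smooth_on U h" "smooth_on U Y" "smooth_on U Z" "w \<in> W"
  shows "dir_deriv X (dir_deriv Y (dir_deriv Z h)) (\<phi> w) =
    dir_deriv (pullback X) (dir_deriv (pullback Y) (dir_deriv (pullback Z) (h \<circ> \<phi>))) w"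
proof -
  have "dir_deriv X (dir_deriv Y (dir_deriv Z h)) (\<phi> w) =
     dir_deriv (pullback X) (dir_deriv Y (dir_deriv Z h) \<circ> \<phi>) w"
    by (intro dir_deriv_pullback smooth_on_dir_deriv U assms)
  also have "\<dots> = dir_deriv (pullback X) (dir_deriv (pullback Y) (dir_deriv (pullback Z) (h \<circ> \<phi>))) w"
    by (rule dir_deriv_cong_open[OF W _ assms(4)]) (simp add: dir_deriv_twice_pullback[OF assms(1,3)])
  finally show ?thesis .
qed

lemma cuspidal_pullback:
  assumes "smooth_on U f" "smooth_on U X" "smooth_on U Y" "w \<in> W"
  shows "cuspidal_curvature f X Y (\<phi> w) = cuspidal_curvature (f \<circ> \<phi>) (pullback X) (pullback Y) w"
    and "cuspidal_torsion f X Y (\<phi> w) = cuspidal_torsion (f \<circ> \<phi>) (pullback X) (pullback Y) w"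
  unfolding cuspidal_curvature_def cuspidal_torsion_def
  using assms by (simp_all add: dir_deriv_pullback dir_deriv_twice_pullback dir_deriv_thrice_pullback)

lemma partial_compose:
  assumes "smooth_on U h" "w \<in> W"
  shows "partial i (h \<circ> \<phi>) w = frechet_derivative h (at (\<phi> w)) (partial i \<phi> w)"
proof -
  have "((\<lambda>w. h (\<phi> w)) has_derivative
      (\<lambda>x. frechet_derivative h (at (\<phi> w)) (frechet_derivative \<phi> (at w) x))) (at w)"
    by (intro has_derivative_compose[where f = \<phi> and g = h] smooth_on_has_derivative[OF assms(1)]
        smooth_on_has_derivative[OF \<phi>] \<phi>_in assms(2))
  from partial_eqI[OF this] show ?thesis by (simp add: o_def partial_def dir_deriv_def)
qed

text \<open>The factor is the Jacobian determinant of \<open>\<phi>\<close>.\<close>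

lemma det2_eq_jacobian:
  fixes w :: "real^2"
  assumes "w \<in> W"
  defines "D \<equiv> frechet_derivative \<theta> (at (\<phi> w))"
  shows "det2 x y = det2 (partial 1 \<phi> w) (partial 2 \<phi> w) * (D x $ 1 * D y $ 2 - D x $ 2 * D y $ 1)"
proof -
  have "x = D x $ 1 *\<^sub>R partial 1 \<phi> w + D x $ 2 *\<^sub>R partial 2 \<phi> w" for x
    using frechet_derivative_\<phi>_\<theta>[OF assms(1), of x]
      frechet_derivative_at[OF has_derivative_partial[OF \<phi> assms(1)], symmetric]
    by (simp add: D_def)
  then have "det2 x y = det2 (D x $ 1 *\<^sub>R partial 1 \<phi> w + D x $ 2 *\<^sub>R partial 2 \<phi> w)
     (D y $ 1 *\<^sub>R partial 1 \<phi> w + D y $ 2 *\<^sub>R partial 2 \<phi> w)" by metis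
  then show ?thesis by (simp only: det2_comb)
qed

end


section \<open>Frontals in an adapted chart\<close>

locale adapted_chart =
  fixes V U W :: "(real^2) set" and f \<nu> :: "real^2 \<Rightarrow> real^3" and p :: "real^2"
    and \<epsilon> :: real and \<gamma> :: "real \<Rightarrow> real^2" and \<phi> \<theta> :: "real^2 \<Rightarrow> real^2"
  assumes frontal: "frontal V f \<nu>" and curve: "singular_curve V f p U \<epsilon> \<gamma>"
    and orthogonal_adapted: "orthogonal_adapted V f U \<epsilon> \<gamma> W \<phi> \<theta>"
begin

sublocale coordinate_change U W \<phi> \<theta>
  using orthogonal_adapted by unfold_locales (simp add: orthogonal_adapted_def)

abbreviation I where "I \<equiv> {-\<epsilon><..<\<epsilon>}"

lemma UV: "U \<subseteq> V" and \<epsilon>: "0 \<in> I" and \<gamma>: "smooth_on I \<gamma>" "\<gamma> 0 = p"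
  using curve by (auto simp: singular_curve_def)

lemma f: "smooth_on U f" and \<nu>: "smooth_on U \<nu>"
proof -
  have "smooth_on V f" "smooth_on V \<nu>"
    using frontal by (simp_all add: frontal_def)
  then show "smooth_on U f" "smooth_on U \<nu>"
    by (simp_all add: smooth_on_subset[OF UV])
qed

lemma \<nu>_unit: "q \<in> U \<Longrightarrow> norm (\<nu> q) = 1"
  and \<nu>_normal: "q \<in> U \<Longrightarrow> frechet_derivative f (at q) x \<bullet> \<nu> q = 0"
  using frontal subsetD[OF UV] by (simp_all add: frontal_def)

lemma \<gamma>_axis: "t \<in> I \<Longrightarrow> \<gamma> t \<in> U \<and> \<theta> (\<gamma> t) $ 2 = 0"
  and axis_\<gamma>: "w \<in> W \<Longrightarrow> w $ 2 = 0 \<Longrightarrow> \<exists>t\<in>I. \<gamma> t = \<phi> w"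
proof -
  have *: "\<gamma> ` I = \<phi> ` {w \<in> W. w $ 2 = 0}"
    using orthogonal_adapted by (simp add: orthogonal_adapted_def)
  show "\<gamma> t \<in> U \<and> \<theta> (\<gamma> t) $ 2 = 0" if "t \<in> I"
  proof -
    have "\<gamma> t \<in> \<phi> ` {w \<in> W. w $ 2 = 0}" unfolding *[symmetric] using that by simp
    then obtain w where "w \<in> W" "w $ 2 = 0" "\<gamma> t = \<phi> w" by auto
    then show ?thesis using \<theta>_\<phi> \<phi>_in by simp
  qed
  show "\<exists>t\<in>I. \<gamma> t = \<phi> w" if "w \<in> W" "w $ 2 = 0"
  proof -
    have "\<phi> w \<in> \<gamma> ` I" unfolding * using that by simp
    then show ?thesis by (elim imageE) auto
  qed
qed

lemma axis_singular: "w \<in> W \<Longrightarrow> w $ 2 = 0 \<Longrightarrow> \<phi> w \<in> singular_set V f \<inter> U"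
proof -
  assume "w \<in> W" "w $ 2 = 0"
  then obtain t where "t \<in> I" "\<gamma> t = \<phi> w" using axis_\<gamma> by blast
  moreover have "\<gamma> ` I = singular_set V f \<inter> U" using curve by (simp add: singular_curve_def)
  ultimately show ?thesis by (metis imageI)
qed

lemma w0: "\<theta> p \<in> W" "\<theta> p $ 2 = 0" "\<phi> (\<theta> p) = p" "p \<in> U"
  using \<gamma>_axis[OF \<epsilon>] \<theta>_in \<phi>_\<theta> \<gamma>(2) by auto

lemma adapted_coord_fields: "adapted_pair V f U \<epsilon> \<gamma> (coord_field \<phi> \<theta> 1) (coord_field \<phi> \<theta> 2)"
  using orthogonal_adapted by (simp add: orthogonal_adapted_def)

lemma orthonormal_axis:
  assumes "w \<in> W" "w $ 2 = 0"
  shows "norm (partial 1 (f \<circ> \<phi>) w) = 1" "norm (partial 2 (partial 2 (f \<circ> \<phi>)) w) = 1"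
    "partial 1 (f \<circ> \<phi>) w \<bullet> partial 2 (partial 2 (f \<circ> \<phi>)) w = 0"
  using orthogonal_adapted assms by (auto simp: orthogonal_adapted_def)

sublocale A: orthogonal_adapted_frontal W "f \<circ> \<phi>" "\<nu> \<circ> \<phi>"
proof
  show "open W" by (rule W)
  show "smooth_on W (f \<circ> \<phi>)" "smooth_on W (\<nu> \<circ> \<phi>)"
    by (intro smooth_compose f \<nu>)+
  fix w assume w: "w \<in> W"
  show "(\<nu> \<circ> \<phi>) w \<bullet> (\<nu> \<circ> \<phi>) w = 1"
    using \<nu>_unit[OF \<phi>_in[OF w]] by (simp add: norm_eq_1)
  show "partial i (f \<circ> \<phi>) w \<bullet> (\<nu> \<circ> \<phi>) w = 0" for i
    using \<nu>_normal[OF \<phi>_in[OF w]] by (simp add: partial_compose[OF f w])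
  assume "w $ 2 = 0"
  note w = w this
  have "dir_deriv (coord_field \<phi> \<theta> 2) f (\<phi> w) = 0"
    using adapted_coord_fields axis_singular[OF w] by (auto simp: adapted_pair_def null_vector_field_def)
  then show "partial 2 (f \<circ> \<phi>) w = 0"
    by (simp add: partial_compose[OF f w(1)] dir_deriv_def coord_field_def \<theta>_\<phi>[OF w(1)])
  show "partial 1 (f \<circ> \<phi>) w \<bullet> partial 1 (f \<circ> \<phi>) w = 1"
    "partial 2 (partial 2 (f \<circ> \<phi>)) w \<bullet> partial 2 (partial 2 (f \<circ> \<phi>)) w = 1"
    "partial 1 (f \<circ> \<phi>) w \<bullet> partial 2 (partial 2 (f \<circ> \<phi>)) w = 0"
    using orthonormal_axis[OF w] by (simp_all add: norm_eq_1)
qed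

text \<open>On the singular set the differential of \<open>f\<close> has rank one, with image spanned by \<open>f\<^sub>u\<close>.\<close>

lemma derivative_axis:
  assumes "w \<in> W" "w $ 2 = 0"
  shows "frechet_derivative f (at (\<phi> w)) x = frechet_derivative \<theta> (at (\<phi> w)) x $ 1 *\<^sub>R A.gu w"
  using frechet_derivative_compose[OF f assms(1), of x] A.gv[OF assms]
  by (simp add: frechet_derivative_at[OF has_derivative_partial[OF A.g assms(1)], symmetric])

lemma gu_nonzero: "w \<in> W \<Longrightarrow> w $ 2 = 0 \<Longrightarrow> A.gu w \<noteq> 0"
  using A.gu_unit by fastforce

text \<open>The curve and the null field witnessing the non-front condition need not be those of the chart.
  Since \<open>df\<close> has rank one at \<open>p\<close>, the witness null vector is \<open>b \<partial>\<^sub>v\<close> for some \<open>b\<close>, and the tangent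
  of the witness curve enters \<open>\<psi>\<close> only through its \<open>\<partial>\<^sub>u\<close>-component \<open>a\<close>.  Transversality says \<open>a b \<noteq> 0\<close>,
  and \<open>\<psi> 0\<close> is \<open>a b\<close> times the determinant formed with \<open>\<partial>\<^sub>u\<close> and \<open>\<partial>\<^sub>v\<close>.\<close>

lemma non_front_imp_partial_N_zero:
  assumes "k \<ge> 1" "non_front k V f \<nu> p"
  shows "partial 2 A.N (\<theta> p) = 0"
proof -
  obtain U' \<epsilon>' \<gamma>' \<eta>' where fk: "first_kind V f \<nu> p U' \<epsilon>' \<gamma>' \<eta>'"
    and "\<forall>i<k. (deriv ^^ i) (psi f \<nu> \<gamma>' \<eta>') 0 = 0"
    using assms(2) by (auto simp: non_front_def)
  then have psi: "psi f \<nu> \<gamma>' \<eta>' 0 = 0" using assms(1) by (metis funpow_0 less_le_trans zero_less_one)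
  have sc: "singular_curve V f p U' \<epsilon>' \<gamma>'" and trans: "det2 (vector_derivative \<gamma>' (at 0)) (\<eta>' p) \<noteq> 0"
    using fk by (auto simp: first_kind_def)
  then have \<gamma>': "smooth_on {-\<epsilon>'<..<\<epsilon>'} \<gamma>'" "0 \<in> {-\<epsilon>'<..<\<epsilon>'}" "\<gamma>' 0 = p" and "p \<in> U'"
    by (auto simp: singular_curve_def)
  have "p \<in> singular_set V f" using fk by (simp add: first_kind_def nondegenerate_singular_def)
  then have null: "frechet_derivative f (at p) (\<eta>' p) = 0"
    using fk \<open>p \<in> U'\<close> by (auto simp: first_kind_def null_vector_field_def dir_deriv_def)
  define c where "c = vector_derivative \<gamma>' (at 0)"
  define x y where "x = frechet_derivative \<theta> (at p) c" and "y = frechet_derivative \<theta> (at p) (\<eta>' p)"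
  note ax = derivative_axis[OF w0(1,2), unfolded w0(3)]
  have "y $ 1 = 0"
    using null gu_nonzero[OF w0(1,2)] by (simp add: ax y_def)
  have "(\<gamma>' has_vector_derivative c) (at 0)"
    using smooth_on_differentiable[OF \<gamma>'(1,2)] by (simp add: c_def vector_derivative_works)
  moreover have "(f has_derivative frechet_derivative f (at p)) (at (\<gamma>' 0) within range \<gamma>')"
    using smooth_on_has_derivative[OF f w0(4)] by (simp add: \<gamma>'(3) has_derivative_at_withinI)
  ultimately have "((f \<circ> \<gamma>') has_vector_derivative frechet_derivative f (at p) c) (at 0)"
    by (rule vector_derivative_diff_chain_within)
  then have "vector_derivative (f \<circ> \<gamma>') (at 0) = x $ 1 *\<^sub>R A.gu (\<theta> p)"
    by (simp add: vector_derivative_at ax x_def)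
  moreover have "dir_deriv \<eta>' \<nu> p = y $ 2 *\<^sub>R A.nv (\<theta> p)"
    using dir_deriv_pullback[OF \<nu> w0(1), of \<eta>'] \<open>y $ 1 = 0\<close> unfolding w0(3)
    by (simp add: dir_deriv_eq_partial[OF A.n w0(1)] pullback_def w0(3) y_def)
  ultimately have "x $ 1 * y $ 2 * det3 (A.gu (\<theta> p)) ((\<nu> \<circ> \<phi>) (\<theta> p)) (A.nv (\<theta> p)) = 0"
    using psi unfolding psi_def \<gamma>'(3)
    by (auto simp: w0(3) det3_eq_cross3_inner cross_mult_left)
  moreover have "x $ 1 * y $ 2 \<noteq> 0"
    using trans det2_eq_jacobian[OF w0(1), of c "\<eta>' p"] \<open>y $ 1 = 0\<close>
    by (auto simp: c_def[symmetric] w0(3) x_def y_def)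
  ultimately have "det3 (A.gu (\<theta> p)) ((\<nu> \<circ> \<phi>) (\<theta> p)) (A.nv (\<theta> p)) = 0" by simp
  then show ?thesis
    using A.partial_N_zero_iff_front_determinant[OF w0(1,2)] by blast
qed

text \<open>In the chart the singular curve runs inside the axis, so its velocity is horizontal.\<close>

lemma \<theta>_\<gamma>_derivative:
  assumes "t \<in> I"
  shows "((\<lambda>t. \<theta> (\<gamma> t)) has_vector_derivative
      frechet_derivative \<theta> (at (\<gamma> t)) (vector_derivative \<gamma> (at t))) (at t)"
    and "frechet_derivative \<theta> (at (\<gamma> t)) (vector_derivative \<gamma> (at t)) $ 2 = 0"
proof -
  let ?c = "frechet_derivative \<theta> (at (\<gamma> t)) (vector_derivative \<gamma> (at t))"
  have "(\<gamma> has_vector_derivative vector_derivative \<gamma> (at t)) (at t)"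
    using smooth_on_differentiable[OF \<gamma>(1) assms] by (simp add: vector_derivative_works)
  moreover have "(\<theta> has_derivative frechet_derivative \<theta> (at (\<gamma> t))) (at (\<gamma> t) within range \<gamma>)"
    using smooth_on_has_derivative[OF \<theta>] \<gamma>_axis[OF assms] by (simp add: has_derivative_at_withinI)
  ultimately show c: "((\<lambda>t. \<theta> (\<gamma> t)) has_vector_derivative ?c) (at t)"
    using vector_derivative_diff_chain_within[of \<gamma> _ t UNIV \<theta>] by (simp add: o_def)
  have "((\<lambda>t. \<theta> (\<gamma> t) $ 2) has_vector_derivative ?c $ 2) (at t)"
    by (rule bounded_linear.has_vector_derivative[OF bounded_linear_vec_nth c])
  moreover have "((\<lambda>t. \<theta> (\<gamma> t) $ 2) has_vector_derivative 0) (at t)"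
    by (rule has_vector_derivative_transform_within_open[of "\<lambda>_. 0" _ _ I])
      (use assms \<gamma>_axis in auto)
  ultimately show "?c $ 2 = 0"
    by (rule vector_derivative_unique_at)
qed

text \<open>On the axis \<open>\<xi>\<close> is tangent to the axis and \<open>\<eta>\<close> lies in the kernel of \<open>df\<close>, spanned by \<open>\<partial>\<^sub>v\<close>.
  Both \<open>(\<xi>, \<eta>)\<close> and the coordinate fields are positively oriented, which fixes the sign of the
  product of the two remaining components.\<close>

lemma adapted_pair_pullback:
  assumes "adapted_pair V f U \<epsilon> \<gamma> \<xi> \<eta>" and w: "w \<in> W" "w $ 2 = 0"
  shows "pullback \<xi> w $ 2 = 0" "pullback \<eta> w $ 1 = 0" "pullback \<xi> w $ 1 * pullback \<eta> w $ 2 > 0"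
proof -
  have tangent: "pullback \<xi> w $ 2 = 0" and null: "pullback \<eta> w $ 1 = 0"
    if "adapted_pair V f U \<epsilon> \<gamma> \<xi> \<eta>" for \<xi> \<eta>
  proof -
    obtain t where t: "t \<in> I" "\<gamma> t = \<phi> w" using axis_\<gamma>[OF w] by blast
    then have "\<xi> (\<phi> w) \<in> span {vector_derivative \<gamma> (at t)}"
      using that by (metis adapted_pair_def)
    then obtain r where "\<xi> (\<phi> w) = r *\<^sub>R vector_derivative \<gamma> (at t)"
      by (auto simp: span_singleton)
    then show "pullback \<xi> w $ 2 = 0"
      using \<theta>_\<gamma>_derivative(2)[OF t(1)]
        linear_scale[OF has_derivative_linear[OF smooth_on_has_derivative[OF \<theta> \<phi>_in[OF w(1)]]]]
      by (simp add: pullback_def t(2))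
    have "dir_deriv \<eta> f (\<phi> w) = 0"
      using that axis_singular[OF w] by (auto simp: adapted_pair_def null_vector_field_def)
    then show "pullback \<eta> w $ 1 = 0"
      using derivative_axis[OF w] gu_nonzero[OF w] by (simp add: dir_deriv_def pullback_def)
  qed
  show 1: "pullback \<xi> w $ 2 = 0" and 2: "pullback \<eta> w $ 1 = 0"
    using tangent null assms(1) by auto
  have "det2 (coord_field \<phi> \<theta> 1 (\<phi> w)) (coord_field \<phi> \<theta> 2 (\<phi> w)) > 0"
    using adapted_coord_fields \<phi>_in[OF w(1)] by (auto simp: adapted_pair_def)
  then have "det2 (partial 1 \<phi> w) (partial 2 \<phi> w) > 0"
    by (simp only: coord_field_def \<theta>_\<phi>[OF w(1)])
  moreover have "det2 (\<xi> (\<phi> w)) (\<eta> (\<phi> w)) > 0"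
    using assms(1) \<phi>_in[OF w(1)] by (auto simp: adapted_pair_def)
  ultimately show "pullback \<xi> w $ 1 * pullback \<eta> w $ 2 > 0"
    using det2_eq_jacobian[OF w(1), of "\<xi> (\<phi> w)" "\<eta> (\<phi> w)"] 1 2
    by (simp add: pullback_def[symmetric] zero_less_mult_iff)
qed

context
  fixes \<xi> \<eta> assumes pair: "adapted_pair V f U \<epsilon> \<gamma> \<xi> \<eta>"
begin

lemma fields: "smooth_on U \<xi>" "smooth_on U \<eta>"
  using pair by (auto simp: adapted_pair_def null_vector_field_def)

lemma cuspidal_curvature_eq:
  assumes "w \<in> W" "w $ 2 = 0"
  shows "cuspidal_curvature f \<xi> \<eta> (\<phi> w) =
    2 * det3 (A.gu w) (A.gvv w) ((\<nu> \<circ> \<phi>) w) * partial 2 A.N w"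
proof -
  have "cuspidal_curvature f \<xi> \<eta> (\<phi> w) = det3 (A.gu w) (A.gvv w) (A.gvvv w)"
    unfolding cuspidal_pullback(1)[OF f fields assms(1)]
    by (rule A.cuspidal_curvature_axis)
      (use assms adapted_pair_pullback[OF pair] smooth_pullback fields in auto)
  also have "\<dots> = det3 (A.gu w) (A.gvv w) ((\<nu> \<circ> \<phi>) w) * (A.gvvv w \<bullet> (\<nu> \<circ> \<phi>) w)"
    using A.frame[OF assms(1)] assms by (intro det3_orthonormal(2)) auto
  finally show ?thesis using A.partial_N(2)[OF assms] by simp
qed

lemma cuspidal_torsion_eq:
  assumes "w \<in> W" "w $ 2 = 0"
  shows "cuspidal_torsion f \<xi> \<eta> (\<phi> w) = det3 (A.gu w) (A.gvv w) ((\<nu> \<circ> \<phi>) w) * partial 2 A.M w"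
proof -
  have "cuspidal_torsion f \<xi> \<eta> (\<phi> w) = det3 (A.gu w) (A.gvv w) (A.guvv w)"
    unfolding cuspidal_pullback(2)[OF f fields assms(1)]
    by (rule A.cuspidal_torsion_axis)
      (use assms adapted_pair_pullback[OF pair] smooth_pullback fields in auto)
  also have "\<dots> = det3 (A.gu w) (A.gvv w) ((\<nu> \<circ> \<phi>) w) * (A.guvv w \<bullet> (\<nu> \<circ> \<phi>) w)"
    using A.frame[OF assms(1)] assms by (intro det3_orthonormal(2)) auto
  finally show ?thesis using A.partial_M[OF assms] by simp
qed

text \<open>Along the axis \<open>\<kappa>\<^sub>c\<close> is the product of \<open>N\<^sub>v\<close>, which vanishes at the non-front point, with a
  smooth function; its derivative there is a multiple of \<open>N\<^sub>u\<^sub>v\<close>.\<close>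

lemma cuspidal_curvature_derivative:
  assumes "partial 2 A.N (\<theta> p) = 0" "deriv (\<lambda>t. cuspidal_curvature f \<xi> \<eta> (\<gamma> t)) 0 \<noteq> 0"
  shows "partial 1 (partial 2 A.N) (\<theta> p) \<noteq> 0"
proof
  assume "partial 1 (partial 2 A.N) (\<theta> p) = 0"
  \<comment> \<open>The value is \<open>\<plusminus> 2\<close> on the axis; the cross product makes the smoothness of \<open>\<delta>\<close> visible.\<close>
  define \<delta> where "\<delta> w = 2 * (cross3 (A.gu w) (A.gvv w) \<bullet> (\<nu> \<circ> \<phi>) w)" for w
  have \<delta>: "smooth_on W \<delta>" unfolding \<delta>_def
    by (intro smooth_on_mult smooth_on_const smooth_on_inner W A.n smooth_on_partial A.g
        smooth_on_bilinear[OF W bilinear_conv_bounded_bilinear[THEN iffD1, OF bilinear_cross]])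
  have dN: "smooth_on W (partial 2 A.N)" by (intro smooth_on_partial A.smooth)
  define K where "K w = \<delta> w * partial 2 A.N w" for w
  have K: "smooth_on W K" unfolding K_def by (intro smooth_on_mult W \<delta> dN)
  have "partial 1 K (\<theta> p) = 0"
    unfolding K_def[abs_def] partial_mult[OF \<delta> dN w0(1)]
    using \<open>partial 1 (partial 2 A.N) (\<theta> p) = 0\<close> assms(1) by simp
  then have "((\<lambda>t. K (\<theta> (\<gamma> t))) has_real_derivative 0) (at 0)"
    using DERIV_along_curve[OF K \<theta>_\<gamma>_derivative(1)[OF \<epsilon>]] \<theta>_\<gamma>_derivative(2)[OF \<epsilon>] w0(1) by (simp add: \<gamma>(2))
  then have "((\<lambda>t. cuspidal_curvature f \<xi> \<eta> (\<gamma> t)) has_real_derivative 0) (at 0)"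
  proof (rule has_field_derivative_transform_within_open[OF _ _ \<epsilon>])
    fix t assume "t \<in> I"
    then have "\<theta> (\<gamma> t) \<in> W" "\<theta> (\<gamma> t) $ 2 = 0" "\<phi> (\<theta> (\<gamma> t)) = \<gamma> t"
      using \<gamma>_axis \<theta>_in \<phi>_\<theta> by auto
    then show "K (\<theta> (\<gamma> t)) = cuspidal_curvature f \<xi> \<eta> (\<gamma> t)"
      using cuspidal_curvature_eq[of "\<theta> (\<gamma> t)"] by (simp add: K_def \<delta>_def det3_eq_cross3_inner)
  qed simp
  then show False using assms(2) DERIV_imp_deriv by blast
qed

end

end

section \<open>Umbilics at non-front singular points\<close>

theorem proposition4p6:
  fixes V U W :: "(real^2) set"
    and f \<nu> :: "real^2 \<Rightarrow> real^3"
    and p :: "real^2" and k :: nat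
    and \<epsilon> :: real and \<gamma> :: "real \<Rightarrow> real^2"
    and \<phi> \<theta> :: "real^2 \<Rightarrow> real^2"
    and \<Gamma>t :: "real^2 \<Rightarrow> real"
  assumes "frontal V f \<nu>"
    and "k \<ge> 1" and "non_front k V f \<nu> p"
    and "singular_curve V f p U \<epsilon> \<gamma>"
    and "orthogonal_adapted V f U \<epsilon> \<gamma> W \<phi> \<theta>"
    and "is_Gamma_tilde f \<nu> U W \<phi> \<Gamma>t"
  shows "p \<in> umbilic_points U \<Gamma>t \<and> critical_point \<Gamma>t p \<and>
    (\<forall>\<xi> \<eta>. adapted_pair V f U \<epsilon> \<gamma> \<xi> \<eta> \<and>
        cuspidal_torsion f \<xi> \<eta> p * deriv (\<lambda>t. cuspidal_curvature f \<xi> \<eta> (\<gamma> t)) 0 \<noteq> 0 \<longrightarrow>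
      morse_at \<Gamma>t p \<and> morse_index \<Gamma>t p \<in> {0, 2} \<and> p isolated_in umbilic_points U \<Gamma>t)"
proof -
  interpret adapted_chart V U W f \<nu> p \<epsilon> \<gamma> \<phi> \<theta>
    by unfold_locales (fact assms)+
  note Nv = non_front_imp_partial_N_zero[OF assms(2,3)]
  define \<alpha> \<beta> \<mu> where "\<alpha> = partial 1 (partial 2 A.N) (\<theta> p)"
    and "\<beta> = partial 2 (partial 2 A.N) (\<theta> p) / 2 - A.L (\<theta> p)" and "\<mu> = partial 2 A.M (\<theta> p)"
  have \<Gamma>: "smooth_on U \<Gamma>t" and "\<And>w. w \<in> W \<Longrightarrow> w $ 2 \<noteq> 0 \<Longrightarrow> \<Gamma>t (\<phi> w) =
      4 * (area_density (f \<circ> \<phi>) (\<nu> \<circ> \<phi>) w)\<^sup>2 *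
      ((mean_curvature (f \<circ> \<phi>) (\<nu> \<circ> \<phi>) w)\<^sup>2 - gaussian_curvature (f \<circ> \<phi>) (\<nu> \<circ> \<phi>) w)"
    using assms(6) by (auto simp: is_Gamma_tilde_def)
  then have "((\<lambda>s. \<Gamma>t (\<phi> (\<theta> p + s *\<^sub>R vector [a, 1])) / s\<^sup>2) \<longlongrightarrow> (\<alpha> * a + \<beta>)\<^sup>2 + 4 * \<mu>\<^sup>2) (at 0)" for a
    unfolding \<alpha>_def \<beta>_def \<mu>_def using A.Gamma_second_order[OF w0(1,2) Nv, of "\<lambda>w. \<Gamma>t (\<phi> w)"] by blast
  note expansion = expansion_from_transverse_lines[OF W smooth_compose[OF \<Gamma>, unfolded o_def] w0(1) this]
  have "\<Gamma>t p = 0" using expansion(1) by (simp add: w0(3))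
  have crit: "(\<Gamma>t has_derivative (\<lambda>_. 0)) (at p)"
  proof -
    have "frechet_derivative (\<Gamma>t \<circ> \<phi>) (at (\<theta> p)) x = 0" for x
      unfolding frechet_derivative_at[OF has_derivative_partial[OF smooth_compose[OF \<Gamma>] w0(1)], symmetric]
      using expansion(2,3) by (simp add: o_def)
    then have "frechet_derivative \<Gamma>t (at p) x = 0" for x
      using frechet_derivative_compose[OF \<Gamma> w0(1), of x] by (simp add: w0(3))
    then show ?thesis using smooth_on_has_derivative[OF \<Gamma> w0(4)] by presburger
  qed
  have grad: "partial i \<Gamma>t p = 0" for i using partial_eqI[OF crit] .
  show ?thesis
  proof (intro conjI allI impI)
    show "p \<in> umbilic_points U \<Gamma>t"
      using \<open>\<Gamma>t p = 0\<close> w0(4) by (simp add: umbilic_points_def)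
    show "critical_point \<Gamma>t p" using crit by (simp add: critical_point_def)
    fix \<xi> \<eta>
    assume *: "adapted_pair V f U \<epsilon> \<gamma> \<xi> \<eta> \<and>
      cuspidal_torsion f \<xi> \<eta> p * deriv (\<lambda>t. cuspidal_curvature f \<xi> \<eta> (\<gamma> t)) 0 \<noteq> 0"
    then have "\<alpha> \<noteq> 0"
      unfolding \<alpha>_def by (intro cuspidal_curvature_derivative[OF _ Nv]) auto
    have "\<mu> \<noteq> 0"
      unfolding \<mu>_def using * cuspidal_torsion_eq[of \<xi> \<eta>, OF _ w0(1,2)] by (auto simp: w0(3))
    have "hessian_form \<Gamma>t p x > 0" if "x \<noteq> 0" for x
    proof -
      define z where "z = frechet_derivative \<theta> (at p) x"
      have x: "x = frechet_derivative \<phi> (at (\<theta> p)) z"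
        using frechet_derivative_\<phi>_\<theta>[OF w0(1), of x] by (simp add: z_def w0(3))
      have "hessian_form \<Gamma>t p x = 2 * ((\<alpha> * z $ 1 + \<beta> * z $ 2)\<^sup>2 + 4 * \<mu>\<^sup>2 * (z $ 2)\<^sup>2)"
        using hessian_form_compose[OF U \<Gamma> W \<phi> _ w0(1), of z] expansion(4)[of z] \<phi>_image \<open>\<Gamma>t p = 0\<close> grad
        by (simp add: w0(3) x)
      moreover have "z \<noteq> 0"
        using x that linear_0[OF has_derivative_linear[OF smooth_on_has_derivative[OF \<phi> w0(1)]]] by auto
      then have "z $ 1 \<noteq> 0 \<or> z $ 2 \<noteq> 0" by (auto simp: vec_eq_iff forall_2)
      then have "(\<alpha> * z $ 1 + \<beta> * z $ 2)\<^sup>2 + 4 * \<mu>\<^sup>2 * (z $ 2)\<^sup>2 > 0"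
        using \<open>\<alpha> \<noteq> 0\<close> \<open>\<mu> \<noteq> 0\<close> by (cases "z $ 2 = 0") (auto intro: add_nonneg_pos)
      ultimately show ?thesis by simp
    qed
    from nondegenerate_minimum[OF U \<Gamma> w0(4) \<open>\<Gamma>t p = 0\<close> grad grad this]
    show "morse_at \<Gamma>t p" "morse_index \<Gamma>t p \<in> {0, 2}" "p isolated_in umbilic_points U \<Gamma>t"
      by (simp_all add: umbilic_points_def)
  qed
qed


end
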